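(* Let $q\equiv 3\pmod 4$ be a prime power, let $a\in\mathbb{F}_q^*$ be such that $1+a^2$ is a nonzero square of $\mathbb{F}_q$, let $d\in\mathbb{F}_q^*$ be such that $d^2=a^{-2}+1$, and let $\mu\in\mathbb{F}_{q^2}$ be such that $\mu^{q+1}=-1$. Let $Q(4,q)$ be the parabolic quadric and $A$ the group acting on its points that are defined in the context, and for a point $P$ of $Q(4,q)$ let $O(P)$ denote the $A$-orbit of $P$. Put $$S=\{\langle (x_1,x_2,y,1)\rangle \in Q(4,q)\mid 1+a^2x_1x_2 \text{ is a nonzero square of } \mathbb{F}_q,\ x_1x_2y\neq 0\}$$ and $$\mathcal{M}=S\cup O(1,0,1,1)\cup O(1,1,\mu,0)\cup O(1,1,0,1)\cup O(-1,1,ad,a).$$ Then $\mathcal{M}$ is a $\frac{q-1}{2}$-ovoid of $Q(4,q)$.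
   Context: Let $q\equiv 3\pmod 4$ be a prime power and let $V=\mathbb{F}_q\times\mathbb{F}_q\times\mathbb{F}_{q^2}\times\mathbb{F}_q$, viewed as a 5-dimensional vector space over $\mathbb{F}_q$. Let $f(x_1,x_2,y,z)=x_1x_2+y^{q+1}-z^2$, which is a non-degenerate quadratic form on $V$. The projective space $\mathrm{PG}(4,q)$ is that of $V$; its points are the one-dimensional $\mathbb{F}_q$-subspaces $\langle (x_1,x_2,y,z)\rangle$ of $V$, also written simply $(x_1,x_2,y,z)$. The points of the parabolic quadric $Q(4,q)$ are $$Q(4,q)=\{\langle (x_1,x_2,y,z)\rangle\mid 0\neq (x_1,x_2,y,z)\in V,\ f(x_1,x_2,y,z)=0\},$$ and the lines of $Q(4,q)$ are the lines of $\mathrm{PG}(4,q)$ all of whose points lie in this set. For a positive integer $m$, an $m$-ovoid of $Q(4,q)$ is a set of points of $Q(4,q)$ that meets every line of $Q(4,q)$ in exactly $m$ points. The group $A$ is the group of projective linear transformations of $\mathrm{PG}(4,q)$, preserving $Q(4,q)$, generated by the maps $$T_{\beta,w}:(x_1,x_2,y,z)\mapsto (\beta x_1,\beta^{-1}x_2,wy,w^{\frac{q+1}{2}}z),$$ where $\beta$ ranges over the nonzero squares of $\mathbb{F}_q$ and $w$ ranges over the elements of $\mathbb{F}_{q^2}$ with $w^{q+1}=1$, together with the two involutions $$\sigma:(x_1,x_2,y,z)\mapsto (x_1,x_2,-y^q,z),\qquad \tau:(x_1,x_2,y,z)\mapsto (x_2,x_1,y,-z).$$ *)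

theory Defs
  imports
    "HOL-Library.Product_Plus"
    "HOL-Library.Cardinality"
    "HOL-Number_Theory.Prime_Powers"
    "HOL-Number_Theory.Cong"
    "HOL-Algebra.Algebraic_Closure_Type"
    "HOL-Algebra.Bij"
    "HOL-Algebra.Group_Action"
begin

text \<open>
  Throughout, the type \<open>'a\<close> plays the role of the field with \<open>q\<^sup>2\<close> elements, and \<open>K\<close> that of its
  subfield with \<open>q\<close> elements. The quadruple \<open>(x1, x2, y, z)\<close> stands for a vector of \<open>V\<close>; its
  coordinates \<open>x1\<close>, \<open>x2\<close>, \<open>z\<close> are restricted to \<open>K\<close>, whereas \<open>y\<close> is arbitrary.
\<close>

type_synonym 'a vec = "'a \<times> 'a \<times> 'a \<times> 'a"

definition is_subfield :: "'a::field set \<Rightarrow> bool" where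
  "is_subfield K \<longleftrightarrow> subfield K (ring_of_type_algebra :: 'a ring)"

text \<open>Squares are taken within \<open>K\<close>: every element of \<open>K\<close> is a square in the quadratic extension.\<close>

definition nonzero_square :: "'a::field set \<Rightarrow> 'a \<Rightarrow> bool" where
  "nonzero_square K x \<longleftrightarrow> (\<exists>s\<in>K. s \<noteq> 0 \<and> x = s\<^sup>2)"

definition V :: "'a::field set \<Rightarrow> 'a vec set" where
  "V K = {(x1, x2, y, z). x1 \<in> K \<and> x2 \<in> K \<and> z \<in> K}"

fun scale :: "'a::field \<Rightarrow> 'a vec \<Rightarrow> 'a vec" where
  "scale c (x1, x2, y, z) = (c * x1, c * x2, c * y, c * z)"

fun quad_form :: "nat \<Rightarrow> 'a::field vec \<Rightarrow> 'a" where
  "quad_form q (x1, x2, y, z) = x1 * x2 + y ^ (q + 1) - z\<^sup>2"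


definition pt :: "'a::field set \<Rightarrow> 'a vec \<Rightarrow> 'a vec set" where
  "pt K v = {scale c v | c. c \<in> K}"

definition PG_points :: "'a::field set \<Rightarrow> 'a vec set set" where
  "PG_points K = {pt K v | v. v \<in> V K \<and> v \<noteq> 0}"

definition lin_indep2 :: "'a::field set \<Rightarrow> 'a vec \<Rightarrow> 'a vec \<Rightarrow> bool" where
  "lin_indep2 K u v \<longleftrightarrow>
     (\<forall>a\<in>K. \<forall>b\<in>K. scale a u + scale b v = 0 \<longrightarrow> a = 0 \<and> b = 0)"

definition span2 :: "'a::field set \<Rightarrow> 'a vec \<Rightarrow> 'a vec \<Rightarrow> 'a vec set" where
  "span2 K u v = {scale a u + scale b v | a b. a \<in> K \<and> b \<in> K}"

text \<open>A line is identified with the set of points contained in a two-dimensional subspace.\<close>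

definition PG_lines :: "'a::field set \<Rightarrow> 'a vec set set set" where
  "PG_lines K =
     {{P \<in> PG_points K. P \<subseteq> span2 K u v} | u v. u \<in> V K \<and> v \<in> V K \<and> lin_indep2 K u v}"


definition Q_points :: "nat \<Rightarrow> 'a::field set \<Rightarrow> 'a vec set set" where
  "Q_points q K = {pt K v | v. v \<in> V K \<and> v \<noteq> 0 \<and> quad_form q v = 0}"

definition Q_lines :: "nat \<Rightarrow> 'a::field set \<Rightarrow> 'a vec set set set" where
  "Q_lines q K = {L \<in> PG_lines K. L \<subseteq> Q_points q K}"

definition m_ovoid :: "nat \<Rightarrow> 'a::field set \<Rightarrow> nat \<Rightarrow> 'a vec set set \<Rightarrow> bool" where
  "m_ovoid q K m M \<longleftrightarrow>
     m > 0 \<and> M \<subseteq> Q_points q K \<and> (\<forall>L \<in> Q_lines q K. card (M \<inter> L) = m)"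


fun T_map :: "nat \<Rightarrow> 'a::field \<Rightarrow> 'a \<Rightarrow> 'a vec \<Rightarrow> 'a vec" where
  "T_map q \<beta> w (x1, x2, y, z) = (\<beta> * x1, inverse \<beta> * x2, w * y, w ^ ((q + 1) div 2) * z)"

fun sigma_map :: "nat \<Rightarrow> 'a::field vec \<Rightarrow> 'a vec" where
  "sigma_map q (x1, x2, y, z) = (x1, x2, - (y ^ q), z)"

fun tau_map :: "'a::field vec \<Rightarrow> 'a vec" where
  "tau_map (x1, x2, y, z) = (x2, x1, y, - z)"

text \<open>
  The transformation of the projective space induced by a map on vectors. It is made extensional
  because the elements of \<^const>\<open>BijGroup\<close> are.
\<close>

definition proj_map :: "'a::field set \<Rightarrow> ('a vec \<Rightarrow> 'a vec) \<Rightarrow> 'a vec set \<Rightarrow> 'a vec set" where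
  "proj_map K g = restrict (\<lambda>P. g ` P) (PG_points K)"

definition A_gens :: "nat \<Rightarrow> 'a::field set \<Rightarrow> ('a vec set \<Rightarrow> 'a vec set) set" where
  "A_gens q K =
     {proj_map K (T_map q \<beta> w) | \<beta> w. nonzero_square K \<beta> \<and> w ^ (q + 1) = 1}
     \<union> {proj_map K (sigma_map q), proj_map K tau_map}"

definition A_group :: "nat \<Rightarrow> 'a::field set \<Rightarrow> ('a vec set \<Rightarrow> 'a vec set) monoid" where
  "A_group q K =
     (BijGroup (PG_points K))\<lparr>carrier := generate (BijGroup (PG_points K)) (A_gens q K)\<rparr>"

definition A_orbit :: "nat \<Rightarrow> 'a::field set \<Rightarrow> 'a vec \<Rightarrow> 'a vec set set" where
  "A_orbit q K v = orbit (A_group q K) (\<lambda>g. g) (pt K v)"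


definition S_set :: "nat \<Rightarrow> 'a::field set \<Rightarrow> 'a \<Rightarrow> 'a vec set set" where
  "S_set q K a =
     {pt K (x1, x2, y, 1) | x1 x2 y.
        (x1, x2, y, 1) \<in> V K \<and> pt K (x1, x2, y, 1) \<in> Q_points q K \<and>
        nonzero_square K (1 + a\<^sup>2 * x1 * x2) \<and> x1 * x2 * y \<noteq> 0}"

definition M_set :: "nat \<Rightarrow> 'a::field set \<Rightarrow> 'a \<Rightarrow> 'a \<Rightarrow> 'a \<Rightarrow> 'a vec set set" where
  "M_set q K a d \<mu> =
     S_set q K a \<union> A_orbit q K (1, 0, 1, 1) \<union> A_orbit q K (1, 1, \<mu>, 0)
       \<union> A_orbit q K (1, 1, 0, 1) \<union> A_orbit q K (- 1, 1, a * d, a)"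

end

theory Submission
  imports Defs "HOL-Number_Theory.Residues"
begin

text \<open>
  Write \<open>\<chi>(x) = x ^ ((q-1)/2)\<close> for the quadratic character of \<open>K\<close> and \<open>\<epsilon>(w) = w ^ ((q+1)/2) = \<plusminus>1\<close>
  for \<open>w\<close> of norm one. Up to corrections on \<open>x1 x2 = 0\<close> and on the zeros of
  \<open>g = z\<^sup>2 + a\<^sup>2 x1 x2\<close>, the set \<open>M\<close> is the set of points where \<open>g\<close> is a nonzero square; on each of
  these two loci the orbits select half of the points, by comparing a value of \<open>\<chi>\<close> with one of \<open>\<epsilon>\<close>.

  A line on which \<open>x1\<close> or \<open>x2\<close> vanishes identically contains, besides two points outside \<open>M\<close>, the
  points \<open>(x, 0, w, 1)\<close> with \<open>x \<noteq> 0\<close> (or the same with \<open>x1\<close>, \<open>x2\<close> exchanged), of which half are in \<open>M\<close>.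
  On any other line \<open>g\<close> restricts to a binary form of nonzero discriminant; after removal of one
  point where \<open>g\<close> is a nonzero square, the numbers \<open>Z\<close> of zeros and \<open>S\<close> of points with nonzero square
  value satisfy \<open>2 S + Z = q - 1\<close>. The zeros are paired by an involution that flips membership in
  \<open>M\<close>. The points with \<open>x1 = 0\<close> and with \<open>x2 = 0\<close> either coincide, in a point outside \<open>M\<close>, or exactly
  one of the two lies in \<open>M\<close>; in the latter case both facts come down to
  \<open>\<chi>(2 - u - 1/u) = \<epsilon>(u)\<close> for \<open>u \<noteq> 1\<close> of norm one.
\<close>

section \<open>A finite field and its quadratic extension\<close>

text \<open>Multiplication by \<open>x\<close> permutes \<open>G\<close>, so the product over
  \<open>G\<close> gains a factor \<open>x ^ card G\<close> and yet is unchanged. This serves for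
  the nonzero elements of \<open>K\<close> and of the whole field.\<close>

lemma power_card_mult_closed:
  fixes G :: "'a::field set"
  assumes "finite G" "0 \<notin> G" "\<And>x y. x \<in> G \<Longrightarrow> y \<in> G \<Longrightarrow> x * y \<in> G" "x \<in> G"
  shows "x ^ card G = 1"
proof -
  have inj: "inj_on ((*) x) G"
    using assms(2,4) by (auto simp: inj_on_def)
  have "(*) x ` G = G"
    by (intro endo_inj_surj inj assms(1)) (use assms(3,4) in auto)
  then have "\<Prod>G = (\<Prod>y\<in>G. x * y)"
    using prod.reindex[OF inj, of id] by simp
  also have "\<dots> = x ^ card G * \<Prod>G"
    by (simp add: prod.distrib)
  finally show ?thesis
    using assms(1,2) by simp
qed

lemma card_power_eq_same_le:
  assumes "n > 1"
  shows "card {x::'a::{field,finite}. x ^ n = x} \<le> n"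
proof -
  let ?p = "monom 1 n - monom 1 1 :: 'a poly"
  have deg: "degree ?p = n"
    using assms degree_add_eq_left[of "- monom 1 1" "monom 1 n :: 'a poly"]
    by (simp add: degree_monom_eq)
  then have "?p \<noteq> 0"
    using assms by auto
  then show ?thesis
    using card_poly_roots_bound[of ?p] deg by (simp add: poly_monom)
qed

lemma card_power_eq_one_le:
  assumes "n > 0"
  shows "card {x::'a::{field,finite}. x ^ n = 1} \<le> n"
proof -
  let ?p = "monom 1 n - 1 :: 'a poly"
  have deg: "degree ?p = n"
    using assms degree_add_eq_left[of "- 1" "monom 1 n :: 'a poly"]
    by (simp add: degree_monom_eq)
  then have "?p \<noteq> 0"
    using assms by auto
  then show ?thesis
    using card_poly_roots_bound[of ?p] deg by (simp add: poly_monom)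
qed

text \<open>The involution \<open>f\<close> matches the elements satisfying \<open>P\<close> with
  those violating it.\<close>

lemma card_half_of_swap:
  assumes "finite Z" "\<And>x. x \<in> Z \<Longrightarrow> f x \<in> Z" "\<And>x. x \<in> Z \<Longrightarrow> f (f x) = x"
    and "\<And>x. x \<in> Z \<Longrightarrow> P (f x) \<longleftrightarrow> \<not> P x"
  shows "2 * card {x\<in>Z. P x} = card Z"
proof -
  have "bij_betw f {x\<in>Z. P x} {x\<in>Z. \<not> P x}"
    by (rule bij_betw_byWitness[where f' = f]) (use assms in auto)
  then have "card {x\<in>Z. P x} = card {x\<in>Z. \<not> P x}"
    by (rule bij_betw_same_card)
  moreover have "card Z = card {x\<in>Z. P x} + card {x\<in>Z. \<not> P x}"
    using assms(1) by (subst card_Un_disjoint[symmetric]) (auto intro: arg_cong[where f = card])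
  ultimately show ?thesis
    by simp
qed

section \<open>Conjugation over the subfield\<close>

locale quadratic_extension =
  fixes q :: nat and K :: "'a::{field,finite} set"
  assumes primepow_q: "primepow q"
    and q_mod_4: "[q = 3] (mod 4)"
    and card_UNIV_q: "CARD('a) = q\<^sup>2"
    and is_subfield_K: "is_subfield K"
    and card_K: "card K = q"
begin

definition cj :: "'a \<Rightarrow> 'a" where "cj y = y ^ q"

text \<open>A power map on the whole field: on \<open>K\<close> it is the quadratic character, but
  \<open>chi_two_minus_trace\<close> also evaluates it at \<open>u - 1\<close>, which need not lie
  in \<open>K\<close>.\<close>

definition chi :: "'a \<Rightarrow> 'a" where "chi x = x ^ ((q - 1) div 2)"

text \<open>On the cyclic group of norm-one elements, which has order \<open>q + 1\<close>, this is
  the quadratic character.\<close>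

definition eps :: "'a \<Rightarrow> 'a" where "eps w = w ^ ((q + 1) div 2)"

lemma q_form: obtains k where "q = 4 * k + 3"
proof -
  have "q mod 4 = 3"
    using q_mod_4 by (simp add: cong_def)
  then have "q = 4 * (q div 4) + 3"
    using div_mult_mod_eq[of q 4] by linarith
  then show ?thesis
    using that by blast
qed

lemma q_ge_3: "q \<ge> 3"
  by (rule q_form) simp

lemma q_eq_half: "q = Suc (2 * ((q - 1) div 2))"
  by (rule q_form) auto

lemma half_eq: "(q + 1) div 2 = Suc ((q - 1) div 2)"
  by (rule q_form) auto

lemma odd_half: "odd ((q - 1) div 2)"
  by (rule q_form) auto

text \<open>Just enough structure to place \<open>K\<close> among the roots of
  \<open>X ^ q - X\<close>; further closure properties are then read off from
  \<open>K_eq\<close>.\<close>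

lemma card_nonzero_K: "card (K - {0}) = q - 1"
  and K_mult: "x \<in> K \<Longrightarrow> y \<in> K \<Longrightarrow> x * y \<in> K"
proof -
  have sub: "subring K (ring_of_type_algebra :: 'a ring)"
    using is_subfield_K subfieldE(1) by (auto simp: is_subfield_def)
  show "x \<in> K \<Longrightarrow> y \<in> K \<Longrightarrow> x * y \<in> K"
    using subringE(6)[OF sub] by (simp add: ring_of_type_algebra_def)
  have "0 \<in> K"
    using subringE(2)[OF sub] by (simp add: ring_of_type_algebra_def)
  then show "card (K - {0}) = q - 1"
    by (simp add: card_K)
qed

text \<open>The elements of \<open>K\<close> are roots of \<open>X ^ q - X\<close>, and that
  polynomial has at most \<open>q = card K\<close> roots.\<close>

lemma K_eq: "K = {x. cj x = x}"
proof (rule card_subset_eq)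
  have "x ^ q = x" if "x \<in> K" for x
  proof (cases "x = 0")
    case True
    then show ?thesis using q_ge_3 by simp
  next
    case False
    then have "x ^ (q - 1) = 1"
      using power_card_mult_closed[of "K - {0}" x] card_nonzero_K K_mult that by auto
    then show ?thesis
      using power_Suc[of x "q - 1"] q_ge_3 by simp
  qed
  then show sub: "K \<subseteq> {x. cj x = x}"
    by (auto simp: cj_def)
  have "card {x::'a. cj x = x} \<le> q"
    using card_power_eq_same_le[of q] q_ge_3 by (auto simp: cj_def)
  then show "card K = card {x. cj x = x}"
    using card_mono[OF _ sub] card_K by simp
qed simp

lemma in_K_iff: "x \<in> K \<longleftrightarrow> cj x = x"
  using K_eq by auto

lemma cj_mult [simp]: "cj (x * y) = cj x * cj y"
  and cj_inverse [simp]: "cj (inverse x) = inverse (cj x)"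
  and cj_divide [simp]: "cj (x / y) = cj x / cj y"
  and cj_power [simp]: "cj (x ^ n) = cj x ^ n"
  and cj_one [simp]: "cj 1 = 1"
  by (simp_all add: cj_def power_mult_distrib power_inverse power_divide mult.commute
      flip: power_mult)

lemma cj_zero_iff [simp]: "cj x = 0 \<longleftrightarrow> x = 0"
  using q_ge_3 by (simp add: cj_def)

lemma cj_zero [simp]: "cj 0 = 0"
  by simp

lemma cj_minus [simp]: "cj (- x) = - cj x"
proof -
  have "odd q"
    by (rule q_form) simp
  then show ?thesis
    by (simp add: cj_def)
qed

lemma cj_cj [simp]: "cj (cj x) = x"
proof (cases "x = 0")
  case False
  then have "x ^ card (UNIV - {0::'a}) = 1"
    by (intro power_card_mult_closed) auto
  then have "x ^ (q\<^sup>2 - 1) = 1"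
    by (simp add: card_UNIV_q)
  moreover have "x ^ q\<^sup>2 = x * x ^ (q\<^sup>2 - 1)"
    using q_ge_3 by (subst power_Suc[symmetric]) auto
  ultimately show ?thesis
    by (simp add: cj_def power2_eq_square flip: power_mult)
qed simp

text \<open>The characteristic divides \<open>q\<^sup>2\<close>, hence is the prime underlying
  \<open>q\<close>; so \<open>cj\<close> is an iterate of Frobenius and therefore additive.\<close>

lemma prime_CHAR: "Factorial_Ring.prime CHAR('a)"
  and q_eq_power_CHAR: "\<exists>n. q = CHAR('a) ^ n"
proof -
  have "CHAR('a) > 0"
    using finite_imp_CHAR_pos[where ?'a = 'a] by simp
  then show *: "Factorial_Ring.prime CHAR('a)"
    by (rule prime_CHAR_semidom)
  obtain p n where p: "Factorial_Ring.prime p" "q = p ^ n"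
    using primepow_q by (auto simp: primepow_def)
  have "CHAR('a) dvd q\<^sup>2"
    using CHAR_dvd_CARD[where ?'a = 'a] card_UNIV_q by simp
  then have "CHAR('a) dvd p"
    using p * by (metis prime_dvd_power)
  then have "CHAR('a) = p"
    using p * by (simp add: primes_dvd_imp_eq)
  then show "\<exists>n. q = CHAR('a) ^ n"
    using p by blast
qed

lemma cj_add [simp]: "cj (x + y) = cj x + cj y"
  using q_eq_power_CHAR freshmans_dream'[OF prime_CHAR] by (auto simp: cj_def)

lemma cj_diff [simp]: "cj (x - y) = cj x - cj y"
  using cj_add[of x "- y"] by simp

lemma cj_numeral [simp]: "cj (numeral n) = numeral n"
proof -
  have "cj (of_nat k) = of_nat k" for k
    by (induction k) simp_all
  from this[of "numeral n"] show ?thesis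
    by simp
qed

lemma two_neq_0 [simp]: "(2::'a) \<noteq> 0"
proof
  assume "(2::'a) = 0"
  then have "CHAR('a) dvd 2"
    using of_nat_eq_0_iff_char_dvd[where ?'a = 'a, of 2] by simp
  then have "CHAR('a) = 2"
    using prime_CHAR by (simp add: primes_dvd_imp_eq)
  then obtain n where n: "q = 2 ^ n"
    using q_eq_power_CHAR by auto
  then have "n \<noteq> 0"
    using q_ge_3 by (cases n) auto
  then have "even q"
    using n by simp
  moreover have "odd q"
    by (rule q_form) simp
  ultimately show False
    by simp
qed

lemma four_neq_0 [simp]: "(4::'a) \<noteq> 0"
proof -
  have "(4::'a) = 2 * 2"
    by simp
  then show ?thesis
    using two_neq_0 by (metis mult_eq_0_iff)
qed

lemma neg_eq_self_iff [simp]: "- x = x \<longleftrightarrow> x = (0::'a)"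
proof
  assume "- x = x"
  then have "2 * x = 0"
    by (metis add.right_inverse mult_2)
  then show "x = 0"
    by simp
qed simp

lemma K_closed [simp]:
  "0 \<in> K" "1 \<in> K" "numeral n \<in> K"
  "x \<in> K \<Longrightarrow> - x \<in> K" "x \<in> K \<Longrightarrow> inverse x \<in> K" "x \<in> K \<Longrightarrow> x ^ k \<in> K"
  "x \<in> K \<Longrightarrow> y \<in> K \<Longrightarrow> x + y \<in> K" "x \<in> K \<Longrightarrow> y \<in> K \<Longrightarrow> x - y \<in> K"
  "x \<in> K \<Longrightarrow> y \<in> K \<Longrightarrow> x * y \<in> K" "x \<in> K \<Longrightarrow> y \<in> K \<Longrightarrow> x / y \<in> K"
  by (simp_all add: in_K_iff)

section \<open>The quadratic character and its norm-one counterpart\<close>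

lemma chi_mult: "chi (x * y) = chi x * chi y"
  and chi_power: "chi (x ^ n) = chi x ^ n"
  and chi_inverse: "chi (inverse x) = inverse (chi x)"
  and chi_divide: "chi (x / y) = chi x / chi y"
  and chi_one [simp]: "chi 1 = 1"
  by (simp_all add: chi_def power_mult_distrib power_divide power_inverse mult.commute
      flip: power_mult)

lemma chi_zero [simp]: "chi 0 = 0"
  using odd_half by (simp add: chi_def odd_pos)

text \<open>Here \<open>q = 3\<close> mod 4 enters: \<open>(q - 1) div 2\<close> is odd, so
  \<open>-1\<close> is a nonsquare of \<open>K\<close>. In contrast \<open>(q + 1) div 2\<close> is
  even, so \<open>eps\<close> does not see signs.\<close>

lemma chi_minus [simp]: "chi (- x) = - chi x"
  using odd_half by (simp add: chi_def)

lemma eps_mult: "eps (x * y) = eps x * eps y"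
  and eps_power: "eps (x ^ n) = eps x ^ n"
  and eps_divide: "eps (x / y) = eps x / eps y"
  and eps_one [simp]: "eps 1 = 1"
  by (simp_all add: eps_def power_mult_distrib power_divide power_inverse mult.commute
      flip: power_mult)

lemma eps_eq_mult_chi: "eps x = x * chi x"
  by (simp only: eps_def chi_def half_eq power_Suc)

lemma eps_minus [simp]: "eps (- x) = eps x"
  by (simp add: eps_eq_mult_chi)

text \<open>Split the exponent as \<open>q = 1 + 2 * ((q - 1) div 2)\<close>. Valid on the whole
  field, this shows that \<open>chi\<close> is a sign on nonzero elements of \<open>K\<close>, and
  later gives the square of \<open>chi (u - 1)\<close>.\<close>

lemma cj_eq_chi: "cj x = x * (chi x)\<^sup>2"
  by (metis cj_def chi_def mult.commute power_Suc power_mult q_eq_half)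

lemma chi_cases:
  assumes "x \<in> K" "x \<noteq> 0"
  shows "chi x = 1 \<or> chi x = - 1"
  using assms cj_eq_chi[of x] by (simp add: in_K_iff power2_eq_1_iff)

lemma eps_cases:
  assumes "w * cj w = 1"
  shows "eps w = 1 \<or> eps w = - 1"
proof -
  have "(eps w)\<^sup>2 = w * cj w"
    by (simp add: eps_eq_mult_chi cj_eq_chi power2_eq_square)
  then show ?thesis
    using assms by (simp add: power2_eq_1_iff)
qed

lemma eps_mult_self:
  assumes "w * cj w = 1"
  shows "eps w * eps w = 1"
  using eps_cases[OF assms] by auto

text \<open>For norm one, \<open>cj w\<close> is the inverse of \<open>w\<close>, and the sign
  \<open>eps w\<close> is its own inverse.\<close>

lemma eps_cj:
  assumes "w * cj w = 1"
  shows "eps (cj w) = eps w"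
  by (metis assms eps_mult eps_mult_self eps_one mult.commute mult.right_neutral mult.assoc)

lemma eps_in_K:
  assumes "w * cj w = 1"
  shows "eps w \<in> K"
  using eps_cases[OF assms] by auto

lemma chi_square:
  assumes "s \<in> K" "s \<noteq> 0"
  shows "chi (s\<^sup>2) = 1"
  using chi_cases[OF assms] by (auto simp: chi_power)

lemma card_square_roots:
  assumes "s \<in> K" "s \<noteq> 0"
  shows "card {t\<in>K. t\<^sup>2 = s\<^sup>2} = 2"
proof -
  have "{t\<in>K. t\<^sup>2 = s\<^sup>2} = {s, - s}"
    using assms by (auto simp: power2_eq_iff)
  then show ?thesis
    using assms by simp
qed

text \<open>Squaring is two-to-one on the nonzero elements of \<open>K\<close>, so there are
  \<open>(q - 1) div 2\<close> nonzero squares; these already exhaust the roots of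
  \<open>X ^ ((q - 1) div 2) - 1\<close> in the whole field.\<close>

lemma nonzero_square_iff:
  assumes "x \<in> K"
  shows "nonzero_square K x \<longleftrightarrow> chi x = 1"
proof -
  let ?S = "(\<lambda>s. s\<^sup>2) ` (K - {0})"
  have "card (K - {0}) = (\<Sum>x\<in>?S. card {s\<in>K-{0}. s\<^sup>2 = x})"
    unfolding card_eq_sum by (subst sum.image_gen[of _ _ "\<lambda>s. s\<^sup>2"]) auto
  also have "\<dots> = (\<Sum>x\<in>?S. 2)"
  proof (rule sum.cong)
    fix x assume "x \<in> ?S"
    then obtain s where s: "s \<in> K" "s \<noteq> 0" "x = s\<^sup>2"
      by auto
    then have "{t\<in>K-{0}. t\<^sup>2 = x} = {t\<in>K. t\<^sup>2 = s\<^sup>2}"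
      by auto
    then show "card {t\<in>K-{0}. t\<^sup>2 = x} = 2"
      using card_square_roots s by simp
  qed simp
  finally have "q - 1 = 2 * card ?S"
    by (simp add: card_nonzero_K)
  then have card_S: "card ?S = (q - 1) div 2"
    by simp
  have "?S \<subseteq> {x. chi x = 1}"
    using chi_square by auto
  moreover have "card {x. chi x = 1} \<le> card ?S"
    unfolding card_S chi_def using q_ge_3 by (intro card_power_eq_one_le) auto
  ultimately have "?S = {x. chi x = 1}"
    by (intro card_seteq) auto
  then have "chi x = 1 \<longleftrightarrow> (\<exists>s\<in>K-{0}. x = s\<^sup>2)"
    by (auto simp: set_eq_iff image_iff)
  then show ?thesis
    by (auto simp: nonzero_square_def)
qed

text \<open>Apply \<open>(u - 1) ^ q = 1/u - 1 = - (u - 1)/u\<close>.\<close>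

lemma chi_two_minus_trace:
  assumes "u * cj u = 1" "u \<noteq> 1"
  shows "chi (2 - u - cj u) = eps u"
proof -
  have u: "u \<noteq> 0" "cj u = 1 / u"
    using assms by (auto simp: eq_divide_eq mult.commute)
  have e: "2 - u - cj u = - ((u - 1)\<^sup>2 / u)"
    using u by (simp add: field_simps power2_eq_square)
  have "(u - 1) * (chi (u - 1))\<^sup>2 = cj (u - 1)"
    by (simp add: cj_eq_chi)
  also have "\<dots> = (u - 1) * (- (1 / u))"
    using u by (simp add: field_simps)
  finally have "(chi (u - 1))\<^sup>2 = - (1 / u)"
    using assms(2) by (subst (asm) mult_left_cancel) auto
  then have "chi (2 - u - cj u) = 1 / eps u"
    by (simp add: e chi_divide chi_power eps_eq_mult_chi)
  then show ?thesis
    using eps_cases[OF assms(1)] by auto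
qed

text \<open>The conic \<open>y\<^sup>2 = x\<^sup>2 + 2bx + c\<close> factors as \<open>(y - x - b)(y + x + b) = c - b\<^sup>2\<close>.\<close>

lemma count_monic_quadratic:
  assumes "b \<in> K" "c \<in> K" "b\<^sup>2 \<noteq> c"
  shows "2 * card {x\<in>K. chi (x\<^sup>2 + 2 * b * x + c) = 1} + card {x\<in>K. x\<^sup>2 + 2 * b * x + c = 0} = q - 1"
proof -
  define g where "g x = x\<^sup>2 + 2 * b * x + c" for x
  define D where "D = c - b\<^sup>2"
  define C where "C = (SIGMA x:K. {y\<in>K. y\<^sup>2 = g x})"
  have D: "D \<in> K" "D \<noteq> 0"
    using assms by (auto simp: D_def)
  have gK: "g x \<in> K" if "x \<in> K" for x
    using that assms by (simp add: g_def)
  \<comment> \<open>The factor \<open>u = y - x - b\<close> parametrises the conic: the other factor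
    is \<open>D / u\<close>, and \<open>y\<close> and \<open>x + b\<close> are recovered as half-sum
    and half-difference.\<close>
  have "bij_betw (\<lambda>u. ((D / u - u) / 2 - b, (D / u + u) / 2)) (K - {0}) C"
  proof (rule bij_betw_byWitness[where f' = "\<lambda>(x, y). y - x - b"])
    have "((D / u + u) / 2)\<^sup>2 = g ((D / u - u) / 2 - b)" if "u \<noteq> 0" for u
    proof -
      define t where "t = (D / u - u) / 2"
      have "2 * t + u = D / u"
        by (simp add: t_def del: right_diff_distrib_numeral)
      then have e1: "u * (2 * t + u) = D"
        using that by simp
      have e2: "(D / u + u) / 2 = t + u"
        by (simp add: t_def field_simps)
      have e3: "(t + u)\<^sup>2 - g (t - b) = u * (2 * t + u) - D"
        by (simp add: g_def D_def power2_eq_square algebra_simps)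
      show ?thesis
        unfolding t_def[symmetric] e2 using e1 e3 by simp
    qed
    then show "(\<lambda>u. ((D / u - u) / 2 - b, (D / u + u) / 2)) ` (K - {0}) \<subseteq> C"
      using assms D by (auto simp: C_def)
    have prod: "(y - x - b) * (y + x + b) = D" if "y\<^sup>2 = g x" for x y
    proof -
      have "(y - x - b) * (y + x + b) - D = y\<^sup>2 - g x"
        by (simp add: g_def D_def power2_eq_square algebra_simps)
      then show ?thesis
        using that by simp
    qed
    show "(\<lambda>(x, y). y - x - b) ` C \<subseteq> K - {0}"
      using prod D assms by (fastforce simp: C_def)
    have half_sum: "(2 * x + 2 * z) / 2 = x + z" for x z :: 'a
      by (simp only: distrib_left[symmetric] nonzero_mult_div_cancel_left[OF two_neq_0])
    show "\<forall>p\<in>C. (\<lambda>u. ((D / u - u) / 2 - b, (D / u + u) / 2)) ((\<lambda>(x, y). y - x - b) p) = p"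
    proof clarify
      fix x y assume "(x, y) \<in> C"
      then have eq: "(y - x - b) * (y + x + b) = D"
        using prod by (simp add: C_def)
      then have "y - x - b \<noteq> 0"
        using D by auto
      then have "D / (y - x - b) = y + x + b"
        using eq by (simp add: field_simps)
      then show "(D / (y - x - b) - (y - x - b)) / 2 - b = x \<and> (D / (y - x - b) + (y - x - b)) / 2 = y"
        by (simp add: half_sum)
    qed
    have "(D / u + u) / 2 - ((D / u - u) / 2 - b) - b = u" for u
      by (simp add: field_simps)
    then show "\<forall>u\<in>K - {0}. (\<lambda>(x, y). y - x - b) ((D / u - u) / 2 - b, (D / u + u) / 2) = u"
      by simp
  qed
  then have card_C: "card C = q - 1"
    using card_nonzero_K by (simp add: bij_betw_same_card)
  \<comment> \<open>The same points are counted again over each \<open>x\<close>: a nonzero square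
    value has two roots, the value zero has one.\<close>
  have fibre: "card {y\<in>K. y\<^sup>2 = g x} = (if chi (g x) = 1 then 2 else 0) + (if g x = 0 then 1 else 0)"
    if x: "x \<in> K" for x
  proof -
    consider "g x = 0" | "chi (g x) = 1" "g x \<noteq> 0" | "chi (g x) \<noteq> 1" "g x \<noteq> 0"
      by blast
    then show ?thesis
    proof cases
      case 1
      then have "{y\<in>K. y\<^sup>2 = g x} = {0}"
        by auto
      then show ?thesis
        using 1 by simp
    next
      case 2
      then obtain s where "s \<in> K" "s \<noteq> 0" "g x = s\<^sup>2"
        using nonzero_square_iff[OF gK[OF x]] by (auto simp: nonzero_square_def)
      then show ?thesis
        using card_square_roots 2 by simp
    next
      case 3
      then have "{y\<in>K. y\<^sup>2 = g x} = {}"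
        using chi_square by force
      then have "card {y\<in>K. y\<^sup>2 = g x} = 0"
        by (simp only: card.empty)
      then show ?thesis
        using 3 by simp
    qed
  qed
  have "card C = (\<Sum>x\<in>K. card {y\<in>K. y\<^sup>2 = g x})"
    by (simp add: C_def card_SigmaI)
  also have "\<dots> = 2 * card {x\<in>K. chi (g x) = 1} + card {x\<in>K. g x = 0}"
    by (simp add: fibre sum.distrib sum.If_cases Int_def)
  finally show ?thesis
    using card_C by (simp add: g_def)
qed

section \<open>Projective points, totally singular planes and the group\<close>

lemma scale_simps [simp]:
  fixes v :: "'a vec"
  shows "scale 1 v = v" "scale 0 v = 0" "scale c 0 = (0 :: 'a vec)"
    "scale b (scale c v) = scale (b * c) v"
    "scale c v = 0 \<longleftrightarrow> c = 0 \<or> v = 0"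
  by (cases v; auto simp: zero_prod_def)+

lemma scale_add_right: "scale c (u + v) = scale c u + scale c (v :: 'a vec)"
  and scale_add_left: "scale (b + c) v = scale b v + scale c (v :: 'a vec)"
  by (cases u; cases v; simp add: algebra_simps)+

lemma V_scale: "c \<in> K \<Longrightarrow> v \<in> V K \<Longrightarrow> scale c v \<in> V K"
  and V_add: "u \<in> V K \<Longrightarrow> v \<in> V K \<Longrightarrow> u + v \<in> V K"
  by (cases u; cases v; simp add: V_def)+

lemma self_in_pt: "v \<in> pt K v"
  using K_closed(2) scale_simps(1) unfolding pt_def by (metis (mono_tags, lifting) mem_Collect_eq)

lemma pt_scale:
  assumes "c \<in> K" "c \<noteq> 0"
  shows "pt K (scale c v) = pt K (v :: 'a vec)"
proof -
  have "\<exists>b'\<in>K. scale b v = scale b' (scale c v)" if "b \<in> K" for b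
    by (rule bexI[of _ "b / c"]) (use assms that in auto)
  moreover have "\<exists>b'\<in>K. scale b (scale c v) = scale b' v" if "b \<in> K" for b
    by (rule bexI[of _ "b * c"]) (use assms that in auto)
  ultimately show ?thesis
    unfolding pt_def by blast
qed

lemma pt_eqD:
  assumes "pt K u = pt K v" "v \<noteq> 0"
  obtains c where "c \<in> K" "c \<noteq> 0" "v = scale c (u :: 'a vec)"
proof -
  have "v \<in> pt K u"
    using assms(1) self_in_pt by simp
  then obtain c where "c \<in> K" "v = scale c u"
    by (auto simp: pt_def)
  then show ?thesis
    using that assms(2) by auto
qed

lemma pt_in_PG_points: "v \<in> V K \<Longrightarrow> v \<noteq> 0 \<Longrightarrow> pt K v \<in> PG_points K"
  unfolding PG_points_def by blast

text \<open>Homogeneity is asked only for scalars in \<open>K\<close>, since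
  \<open>sigma_map\<close> conjugates the scalars outside.\<close>

lemma proj_map_pt:
  assumes "v \<in> V K" "v \<noteq> 0" "\<And>c v. c \<in> K \<Longrightarrow> g (scale c v) = scale c (g v)"
  shows "proj_map K g (pt K v) = pt K (g v)"
proof -
  have pt: "pt K u = (\<lambda>c. scale c u) ` K" for u :: "'a vec"
    by (auto simp: pt_def)
  have "g ` pt K v = pt K (g v)"
    unfolding pt image_image by (intro image_cong refl assms(3))
  then show ?thesis
    using assms(1,2) by (simp add: proj_map_def pt_in_PG_points)
qed

text \<open>Injectivity passes from vectors to sets of vectors; finiteness of the set of points then
  gives surjectivity.\<close>

lemma proj_map_in_Bij:
  assumes hom: "\<And>c v. c \<in> K \<Longrightarrow> g (scale c v) = scale c (g v)"
    and "inj g" and V: "\<And>v. v \<in> V K \<Longrightarrow> g v \<in> V K"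
  shows "proj_map K g \<in> Bij (PG_points K)"
proof -
  have "g 0 = 0"
    using hom[of 0 0] by simp
  then have nz: "g v \<noteq> 0" if "v \<noteq> 0" for v
    using that \<open>inj g\<close> by (metis injD)
  have "inj_on (proj_map K g) (PG_points K)"
    using \<open>inj g\<close> by (auto simp: inj_on_def proj_map_def inj_image_eq_iff)
  moreover have "proj_map K g ` PG_points K \<subseteq> PG_points K"
  proof safe
    fix P assume "P \<in> PG_points K"
    then obtain v where "v \<in> V K" "v \<noteq> 0" "P = pt K v"
      by (auto simp: PG_points_def)
    then show "proj_map K g P \<in> PG_points K"
      using V nz by (simp add: proj_map_pt[OF _ _ hom] pt_in_PG_points)
  qed
  ultimately have "bij_betw (proj_map K g) (PG_points K) (PG_points K)"
    by (simp add: bij_betw_def endo_inj_surj)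
  then show ?thesis
    by (simp add: Bij_def proj_map_def)
qed

section \<open>The generators and their orbits\<close>

lemma T_map_scale: "T_map q \<beta> w (scale c v) = scale c (T_map q \<beta> w v)"
  and tau_map_scale: "tau_map (scale c v) = scale c (tau_map v)"
  by (cases v; simp)+

lemma sigma_map_scale: "c \<in> K \<Longrightarrow> sigma_map q (scale c v) = scale c (sigma_map q v)"
  by (cases v) (simp add: power_mult_distrib in_K_iff cj_def)

lemma inj_T_map:
  assumes "\<beta> \<noteq> 0" "w \<noteq> 0"
  shows "inj (T_map q \<beta> w)"
  using assms by (auto intro!: injI)

lemma inj_sigma_map: "inj (sigma_map q :: 'a vec \<Rightarrow> 'a vec)"
proof (rule inj_on_inverseI)
  fix v :: "'a vec"
  obtain x1 x2 y z where "v = (x1, x2, y, z)"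
    by (cases v)
  moreover have "- ((- (y ^ q)) ^ q) = y"
    using cj_cj[of y] cj_minus[of "cj y"] by (simp add: cj_def)
  ultimately show "sigma_map q (sigma_map q v) = v"
    by simp
qed

lemma inj_tau_map: "inj (tau_map :: 'a vec \<Rightarrow> 'a vec)"
  by (auto intro!: injI)

lemma A_gens_cases:
  assumes "g \<in> A_gens q K"
  obtains \<beta> w where "\<beta> \<in> K" "\<beta> \<noteq> 0" "chi \<beta> = 1" "w * cj w = 1" "g = proj_map K (T_map q \<beta> w)"
  | "g = proj_map K (sigma_map q)" | "g = proj_map K tau_map"
proof -
  have "\<beta> \<in> K \<and> \<beta> \<noteq> 0 \<and> chi \<beta> = 1" if "nonzero_square K \<beta>" for \<beta>
    using that nonzero_square_iff[of \<beta>] by (auto simp: nonzero_square_def)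
  moreover have "w * cj w = 1" if "w ^ (q + 1) = 1" for w
    using that by (simp add: cj_def)
  ultimately show ?thesis
    using assms that unfolding A_gens_def by blast
qed

lemma T_map_in_V:
  assumes "\<beta> \<in> K" "w * cj w = 1" "v \<in> V K"
  shows "T_map q \<beta> w v \<in> V K"
  using assms eps_in_K[OF assms(2)] by (cases v) (simp add: V_def eps_def)

lemma sigma_map_in_V: "v \<in> V K \<Longrightarrow> sigma_map q v \<in> V K"
  and tau_map_in_V: "v \<in> V K \<Longrightarrow> tau_map v \<in> V K"
  by (cases v; simp add: V_def)+

lemma A_gens_subset_Bij: "A_gens q K \<subseteq> Bij (PG_points K)"
proof
  fix g assume "g \<in> A_gens q K"
  then show "g \<in> Bij (PG_points K)"
  proof (cases rule: A_gens_cases)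
    case (1 \<beta> w)
    then have "w \<noteq> 0"
      by auto
    with 1 show ?thesis
      by (simp add: proj_map_in_Bij inj_T_map T_map_scale T_map_in_V)
  next
    case 2
    then show ?thesis
      by (simp add: proj_map_in_Bij inj_sigma_map sigma_map_scale sigma_map_in_V)
  next
    case 3
    then show ?thesis
      by (simp add: proj_map_in_Bij inj_tau_map tau_map_scale tau_map_in_V)
  qed
qed

lemma A_orbit_eq:
  "A_orbit q K v = (\<lambda>g. g (pt K v)) ` generate (BijGroup (PG_points K)) (A_gens q K)"
  by (auto simp: A_orbit_def orbit_def A_group_def)

text \<open>Finiteness makes closure under the generators suffice: it entails closure under their inverses.\<close>

lemma A_orbit_subset:
  assumes "D \<subseteq> PG_points K" "pt K v \<in> D"
    and gens: "\<And>g P. g \<in> A_gens q K \<Longrightarrow> P \<in> D \<Longrightarrow> g P \<in> D"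
  shows "A_orbit q K v \<subseteq> D"
proof -
  let ?G = "BijGroup (PG_points K)"
  have carrier: "carrier ?G = Bij (PG_points K)"
    by (simp add: BijGroup_def)
  have "g \<in> Bij (PG_points K) \<and> (\<forall>P\<in>D. g P \<in> D)" if "g \<in> generate ?G (A_gens q K)" for g
    using that
  proof (induction rule: generate.induct)
    case one
    have "\<one>\<^bsub>?G\<^esub> = (\<lambda>P\<in>PG_points K. P)"
      by (simp only: BijGroup_def monoid.simps)
    then show ?case
      using assms(1) by (metis id_Bij restrict_apply' subsetD)
  next
    case (incl h)
    then show ?case
      using gens A_gens_subset_Bij by auto
  next
    case (inv h)
    then have h: "h \<in> Bij (PG_points K)"
      using A_gens_subset_Bij by auto
    then have inj: "inj_on h (PG_points K)"
      by (simp add: Bij_def bij_betw_def)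
    have "h ` D = D"
      by (intro endo_inj_surj inj_on_subset[OF inj assms(1)]) (use inv gens in auto)
    have "inv_into (PG_points K) h P \<in> D" if "P \<in> D" for P
    proof -
      obtain P' where "P' \<in> D" "P = h P'"
        using \<open>P \<in> D\<close> \<open>h ` D = D\<close> by blast
      then show ?thesis
        using assms(1) inv_into_f_f[OF inj] by auto
    qed
    then have "\<forall>P\<in>D. (inv\<^bsub>?G\<^esub> h) P \<in> D"
      using assms(1) by (auto simp: inv_BijGroup[OF h])
    moreover have "inv\<^bsub>?G\<^esub> h \<in> Bij (PG_points K)"
      using restrict_inv_into_Bij[OF h] by (simp only: inv_BijGroup[OF h])
    ultimately show ?case
      by blast
  next
    case (eng g h)
    then show ?case
      using assms(1) by (auto simp: BijGroup_def compose_Bij compose_eq)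
  qed
  then show ?thesis
    using assms(2) by (auto simp: A_orbit_eq)
qed

lemma A_orbit_self:
  assumes "v \<in> V K" "v \<noteq> 0"
  shows "pt K v \<in> A_orbit q K v"
  unfolding A_orbit_eq
proof (rule image_eqI[OF _ generate.one])
  show "pt K v = \<one>\<^bsub>BijGroup (PG_points K)\<^esub> (pt K v)"
    using pt_in_PG_points[OF assms] by (simp add: BijGroup_def)
qed

lemma A_orbit_closed:
  assumes v: "v \<in> V K" "v \<noteq> 0" and g: "g \<in> A_gens q K" and P: "P \<in> A_orbit q K v"
  shows "g P \<in> A_orbit q K v"
proof -
  let ?G = "BijGroup (PG_points K)"
  obtain h where h: "h \<in> generate ?G (A_gens q K)" "P = h (pt K v)"
    using P by (auto simp: A_orbit_eq)
  have "h \<in> carrier ?G"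
    by (rule group.generate_in_carrier[OF group_BijGroup _ h(1)])
      (simp add: BijGroup_def A_gens_subset_Bij)
  then have "(g \<otimes>\<^bsub>?G\<^esub> h) (pt K v) = g P"
    using g h(2) A_gens_subset_Bij pt_in_PG_points[OF v]
    by (auto simp: BijGroup_def compose_eq)
  moreover have "g \<otimes>\<^bsub>?G\<^esub> h \<in> generate ?G (A_gens q K)"
    by (rule generate.eng[OF generate.incl[OF g] h(1)])
  ultimately show ?thesis
    unfolding A_orbit_eq by (metis image_eqI)
qed

lemma A_orbit_T:
  assumes "v \<in> V K" "v \<noteq> 0" "u \<in> V K" "u \<noteq> 0" "\<beta> \<in> K" "chi \<beta> = 1" "w * cj w = 1"
    and "pt K u \<in> A_orbit q K v"
  shows "pt K (T_map q \<beta> w u) \<in> A_orbit q K v"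
proof -
  have "proj_map K (T_map q \<beta> w) \<in> A_gens q K"
    using assms(5-7) nonzero_square_iff by (auto simp: A_gens_def cj_def)
  from A_orbit_closed[OF assms(1,2) this assms(8)] show ?thesis
    using assms(3,4) by (simp add: proj_map_pt T_map_scale)
qed

lemma A_orbit_tau:
  assumes "v \<in> V K" "v \<noteq> 0" "u \<in> V K" "u \<noteq> 0" "pt K u \<in> A_orbit q K v"
  shows "pt K (tau_map u) \<in> A_orbit q K v"
proof -
  have "proj_map K tau_map \<in> A_gens q K"
    by (simp add: A_gens_def)
  from A_orbit_closed[OF assms(1,2) this assms(5)] show ?thesis
    using assms(3,4) by (simp add: proj_map_pt tau_map_scale)
qed

lemma card_span2:
  assumes "lin_indep2 K u (v :: 'a vec)"
  shows "card (span2 K u v) = q\<^sup>2"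
proof -
  have "inj_on (\<lambda>(b, c). scale b u + scale c v) (K \<times> K)"
  proof (rule inj_onI, clarify)
    fix b c b' c'
    assume K: "b \<in> K" "c \<in> K" "b' \<in> K" "c' \<in> K"
      and eq: "scale b u + scale c v = scale b' u + scale c' v"
    have "scale (b - b') u + scale (c - c') v = 0"
      using eq by (cases u; cases v) (simp add: zero_prod_def algebra_simps)
    moreover have "b - b' \<in> K" "c - c' \<in> K"
      using K by simp_all
    ultimately have "b - b' = 0 \<and> c - c' = 0"
      using assms unfolding lin_indep2_def by blast
    then show "b = b' \<and> c = c'"
      by simp
  qed
  then have "card ((\<lambda>(b, c). scale b u + scale c v) ` (K \<times> K)) = q\<^sup>2"
    by (simp add: card_image card_cartesian_product card_K power2_eq_square)
  moreover have "(\<lambda>(b, c). scale b u + scale c v) ` (K \<times> K) = span2 K u v"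
    by (auto simp: span2_def)
  ultimately show ?thesis
    by simp
qed

section \<open>Singular vectors and totally singular planes\<close>

lemma quad_form_eq: "quad_form q (x1, x2, y, z) = x1 * x2 + y * cj y - z\<^sup>2"
  by (simp add: cj_def)

lemma quad_form_scale: "c \<in> K \<Longrightarrow> quad_form q (scale c v) = c\<^sup>2 * quad_form q v"
  by (cases v) (simp add: power_mult_distrib in_K_iff cj_def power2_eq_square algebra_simps)

definition singular_vecs :: "'a vec set" where
  "singular_vecs = {v \<in> V K. v \<noteq> 0 \<and> quad_form q v = 0}"

lemma singular_vecs_iff:
  "(x1, x2, y, z) \<in> singular_vecs \<longleftrightarrow>
     x1 \<in> K \<and> x2 \<in> K \<and> z \<in> K \<and> (x1, x2, y, z) \<noteq> (0, 0, 0, 0) \<and> x1 * x2 + y * cj y = z\<^sup>2"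
  by (auto simp: singular_vecs_def V_def cj_def zero_prod_def)

lemma singular_vecs_scale:
  "c \<in> K \<Longrightarrow> c \<noteq> 0 \<Longrightarrow> v \<in> singular_vecs \<Longrightarrow> scale c v \<in> singular_vecs"
  by (simp add: singular_vecs_def V_scale quad_form_scale)

lemma pt_in_Q_points_iff:
  assumes "v \<in> V K" "v \<noteq> 0"
  shows "pt K v \<in> Q_points q K \<longleftrightarrow> v \<in> singular_vecs"
proof
  assume "pt K v \<in> Q_points q K"
  then obtain u where u: "quad_form q u = 0" "pt K u = pt K v"
    by (auto simp: Q_points_def)
  then obtain c where "c \<in> K" "c \<noteq> 0" "v = scale c u"
    using pt_eqD assms(2) by metis
  then show "v \<in> singular_vecs"
    using u assms by (simp add: singular_vecs_def quad_form_scale)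
next
  assume "v \<in> singular_vecs"
  then show "pt K v \<in> Q_points q K"
    unfolding singular_vecs_def Q_points_def by blast
qed

text \<open>A factor \<open>w\<close> of norm one preserves \<open>y * cj y\<close>, and the factor
  \<open>eps w\<close> on \<open>z\<close> is a sign.\<close>

lemma T_map_singular:
  assumes "v \<in> singular_vecs" "\<beta> \<in> K" "\<beta> \<noteq> 0" "w * cj w = 1"
  shows "T_map q \<beta> w v \<in> singular_vecs"
proof -
  obtain x1 x2 y z where v: "v = (x1, x2, y, z)"
    by (cases v)
  have "w * y * cj (w * y) = (w * cj w) * (y * cj y)"
    by (simp add: algebra_simps)
  then have 1: "w * y * cj (w * y) = y * cj y"
    using assms(4) by simp
  have 2: "(eps w * z)\<^sup>2 = z\<^sup>2"
    using eps_cases[OF assms(4)] by (auto simp: power_mult_distrib)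
  have 3: "\<beta> * x1 * (inverse \<beta> * x2) = x1 * x2"
    using assms(3) by (simp add: field_simps)
  have T: "T_map q \<beta> w v = (\<beta> * x1, inverse \<beta> * x2, w * y, eps w * z)"
    by (simp add: v eps_def)
  have "w \<noteq> 0" "eps w \<noteq> 0" "eps w \<in> K"
    using assms(4) eps_cases[OF assms(4)] eps_in_K by auto
  then show ?thesis
    using assms unfolding T unfolding v singular_vecs_iff 1 2 3 by simp
qed

lemma sigma_map_singular: "v \<in> singular_vecs \<Longrightarrow> sigma_map q v \<in> singular_vecs"
  by (cases v) (simp add: singular_vecs_iff mult.commute flip: cj_def)

lemma tau_map_singular: "v \<in> singular_vecs \<Longrightarrow> tau_map v \<in> singular_vecs"
  by (cases v) (auto simp: singular_vecs_iff mult.commute)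

lemma pt_in_T_orbit:
  assumes "v \<in> singular_vecs" "u \<in> singular_vecs" "pt K u \<in> A_orbit q K v"
    and "\<beta> \<in> K" "chi \<beta> = 1" "w * cj w = 1" "c \<in> K" "c \<noteq> 0"
  shows "pt K (scale c (T_map q \<beta> w u)) \<in> A_orbit q K v"
  using A_orbit_T[of v u \<beta> w] assms by (simp add: pt_scale singular_vecs_def)

text \<open>The vector-space form of a line of the quadric: given closure under sums and scalars,
  \<open>card W = q\<^sup>2\<close> stands for dimension two.\<close>

definition singular_plane :: "'a vec set \<Rightarrow> bool" where
  "singular_plane W \<longleftrightarrow> W \<subseteq> V K \<and> (\<forall>w\<in>W. quad_form q w = 0) \<and>
     (\<forall>u\<in>W. \<forall>v\<in>W. u + v \<in> W) \<and> (\<forall>c\<in>K. \<forall>v\<in>W. scale c v \<in> W) \<and> card W = q\<^sup>2"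

lemma Q_line_singular_plane:
  assumes "L \<in> Q_lines q K"
  obtains W where "singular_plane W" "L = {P \<in> PG_points K. P \<subseteq> W}"
proof -
  obtain u v where uv: "u \<in> V K" "v \<in> V K" "lin_indep2 K u v"
    and L: "L = {P \<in> PG_points K. P \<subseteq> span2 K u v}" and sing: "L \<subseteq> Q_points q K"
    using assms by (auto simp: Q_lines_def PG_lines_def)
  let ?W = "span2 K u v"
  have VW: "?W \<subseteq> V K"
    using uv by (auto simp: span2_def V_add V_scale)
  have scale: "scale c w \<in> ?W" if "c \<in> K" "w \<in> ?W" for c w
    using that by (fastforce simp: span2_def scale_add_right)
  have "w + w' \<in> ?W" if w: "w \<in> ?W" "w' \<in> ?W" for w w'
  proof -
    obtain b c b' c' where K: "b \<in> K" "c \<in> K" "b' \<in> K" "c' \<in> K"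
      and "w = scale b u + scale c v" "w' = scale b' u + scale c' v"
      using w unfolding span2_def by blast
    then have "w + w' = scale (b + b') u + scale (c + c') v"
      by (simp add: scale_add_left add_ac)
    then show ?thesis
      using K unfolding span2_def by (metis (mono_tags, lifting) K_closed(7) mem_Collect_eq)
  qed
  moreover have "quad_form q w = 0" if w: "w \<in> ?W" for w
  proof (cases "w = 0")
    case True
    then show ?thesis
      by (simp add: zero_prod_def quad_form_eq del: quad_form.simps)
  next
    case False
    \<comment> \<open>A nonzero vector of the span gives a point of the line, hence of the quadric;
      singularity of some representative transfers to \<open>w\<close> by scaling.\<close>
    have "pt K w \<subseteq> ?W"
      using scale w unfolding pt_def by blast
    then have "pt K w \<in> Q_points q K"
      using L sing w VW False pt_in_PG_points by blast
    then obtain w' where w': "quad_form q w' = 0" "pt K w' = pt K w"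
      by (auto simp: Q_points_def)
    then obtain c where "c \<in> K" "w = scale c w'"
      using pt_eqD False by metis
    then show ?thesis
      using w' by (simp add: quad_form_scale)
  qed
  ultimately have "singular_plane ?W"
    using VW scale card_span2[OF uv(3)] by (simp add: singular_plane_def)
  then show ?thesis
    using L that by blast
qed

text \<open>Pigeonhole in place of rank-nullity: a functional from \<open>q\<^sup>2\<close> vectors
  to \<open>q\<close> values takes some value twice, and the difference of two such vectors is in
  the kernel.\<close>

lemma singular_plane_kernel:
  assumes W: "singular_plane W" and add: "\<And>u v. \<phi> (u + v) = \<phi> u + (\<phi> v :: 'a)"
    and scale: "\<And>c v. \<phi> (scale c v) = c * \<phi> v" and K: "\<And>v. v \<in> W \<Longrightarrow> \<phi> v \<in> K"
  obtains w where "w \<in> W" "w \<noteq> 0" "\<phi> w = 0"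
proof -
  have "card (\<phi> ` W) \<le> card K"
    using K by (intro card_mono) auto
  also have "\<dots> < card W"
    using W q_ge_3 by (simp add: singular_plane_def card_K power2_eq_square)
  finally have "\<not> inj_on \<phi> W"
    using card_image[of \<phi> W] by auto
  then obtain u v where uv: "u \<in> W" "v \<in> W" "u \<noteq> v" "\<phi> u = \<phi> v"
    unfolding inj_on_def by blast
  have "u + scale (- 1) v \<noteq> 0"
    using uv(3) by (cases u; cases v) (auto simp: zero_prod_def eq_neg_iff_add_eq_0 add_eq_0_iff)
  moreover have "u + scale (- 1) v \<in> W"
    using uv W by (simp add: singular_plane_def)
  ultimately show ?thesis
    using that uv(4) by (simp add: add scale)
qed

lemma singular_plane_mem:
  assumes "singular_plane W" "(x1, x2, y, z) \<in> W"
  shows "x1 \<in> K" "x2 \<in> K" "z \<in> K" "x1 * x2 + y * cj y = z\<^sup>2"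
  using assms quad_form_eq[of x1 x2 y z] by (auto simp: singular_plane_def V_def)

lemma singular_plane_comb:
  assumes "singular_plane W" "(x1, x2, y, z) \<in> W" "(x1', x2', y', z') \<in> W" "b \<in> K" "c \<in> K"
  shows "(b * x1 + c * x1', b * x2 + c * x2', b * y + c * y', b * z + c * z') \<in> W"
proof -
  have "scale b (x1, x2, y, z) + scale c (x1', x2', y', z') \<in> W"
    using assms unfolding singular_plane_def by blast
  then show ?thesis
    by simp
qed

text \<open>The functionals are the first and the last coordinate. The vector with
  \<open>x1 = 0\<close> starts the treatment of a general line, the one with \<open>z = 0\<close>
  that of a line inside \<open>x1 = 0\<close> or \<open>x2 = 0\<close>.\<close>

lemma singular_plane_kernel_coords:
  assumes "singular_plane W"
  obtains x2 y z where "(0, x2, y, z) \<in> W" "(0, x2, y, z) \<noteq> (0, 0, 0, 0)"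
    and "\<exists>x1 x2 y. (x1, x2, y, 0) \<in> W \<and> (x1, x2, y, 0) \<noteq> (0, 0, 0, 0)"
proof -
  have coords: "fst (scale c v) = c * fst v" "snd (snd (snd (scale c v))) = c * snd (snd (snd v))"
    for c and v :: "'a vec"
    by (cases v; simp)+
  have V: "fst v \<in> K" "snd (snd (snd v)) \<in> K" if "v \<in> W" for v
    using that assms by (cases v; force simp: singular_plane_def V_def)+
  obtain v where v: "v \<in> W" "v \<noteq> 0" "fst v = 0"
    by (rule singular_plane_kernel[OF assms, of fst]) (auto simp: coords V)
  obtain w where w: "w \<in> W" "w \<noteq> 0" "snd (snd (snd w)) = 0"
    by (rule singular_plane_kernel[OF assms, of "\<lambda>v. snd (snd (snd v))"]) (auto simp: coords V)
  obtain x2 y z where "v = (0, x2, y, z)"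
    using v(3) by (cases v) auto
  moreover obtain x1' x2' y' where "w = (x1', x2', y', 0)"
    using w(3) by (cases w) auto
  ultimately show ?thesis
    using v(1,2) w(1,2) unfolding zero_prod_def by (intro that[of x2 y z]) blast+
qed

end

section \<open>The points of the set\<close>

locale ovoid_data = quadratic_extension q K for q :: nat and K :: "'a::{field,finite} set" +
  fixes a d \<mu> :: 'a
  assumes a: "a \<in> K" "a \<noteq> 0"
    and d: "d \<in> K" "d \<noteq> 0"
    and ad: "a\<^sup>2 * d\<^sup>2 = 1 + a\<^sup>2"
    and mu: "\<mu> * cj \<mu> = - 1"
begin

text \<open>The first clause covers \<open>S_set\<close> and the orbits of
  \<open>(1, 1, \<mu>, 0)\<close> and \<open>(1, 1, 0, 1)\<close>, the next two the orbit of
  \<open>(1, 0, 1, 1)\<close>, the last that of \<open>(- 1, 1, a * d, a)\<close>. As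
  \<open>chi 0 = 0\<close> while \<open>eps\<close> is a sign on norm-one elements, singular vectors
  with \<open>x1 = x2 = 0\<close> fail every clause.\<close>

fun in_M :: "'a vec \<Rightarrow> bool" where
  "in_M (x1, x2, y, z) \<longleftrightarrow>
     x1 \<noteq> 0 \<and> x2 \<noteq> 0 \<and> chi (z\<^sup>2 + a\<^sup>2 * x1 * x2) = 1 \<or>
     z \<noteq> 0 \<and> (x2 = 0 \<and> chi (x1 * z) = eps (y / z) \<or>
       x1 = 0 \<and> chi (- (x2 * z)) = eps (y / z) \<or>
       z\<^sup>2 + a\<^sup>2 * x1 * x2 = 0 \<and> chi (- (a * x1 * z)) = eps (y / (z * d)))"

text \<open>The arguments of \<open>chi\<close> are quadratic in the coordinates, so they pick up
  the square \<open>c\<^sup>2\<close>; those of \<open>eps\<close> are ratios.\<close>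

lemma in_M_scale:
  assumes "c \<in> K" "c \<noteq> 0"
  shows "in_M (scale c v) \<longleftrightarrow> in_M v"
proof -
  obtain x1 x2 y z where v: "v = (x1, x2, y, z)"
    by (cases v)
  have sq: "chi (c\<^sup>2 * x) = chi x" for x
    using chi_square[OF assms] by (simp add: chi_mult)
  have "(c * z)\<^sup>2 + a\<^sup>2 * (c * x1) * (c * x2) = c\<^sup>2 * (z\<^sup>2 + a\<^sup>2 * x1 * x2)"
    "c * x1 * (c * z) = c\<^sup>2 * (x1 * z)" "- (c * x2 * (c * z)) = c\<^sup>2 * (- (x2 * z))"
    "- (a * (c * x1) * (c * z)) = c\<^sup>2 * (- (a * x1 * z))"
    by (simp_all add: power2_eq_square algebra_simps)
  moreover have "c * y / (c * z) = y / z" "c * y / (c * z * d) = y / (z * d)"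
    using assms by (simp_all add: mult.assoc)
  ultimately show ?thesis
    using assms unfolding v scale.simps in_M.simps by (simp only: sq) simp
qed

section \<open>Invariance of membership under the generators\<close>

lemma norm_one_axis:
  assumes "(x1, x2, y, z) \<in> singular_vecs" "z \<noteq> 0" "x1 = 0 \<or> x2 = 0"
  shows "(y / z) * cj (y / z) = 1"
  using assms by (auto simp: singular_vecs_iff in_K_iff power2_eq_square)

text \<open>This is the reason for the choice of \<open>d\<close>: on the zeros of
  \<open>z\<^sup>2 + a\<^sup>2 * x1 * x2\<close>, the norm \<open>z\<^sup>2 - x1 * x2\<close> of
  \<open>y\<close> becomes \<open>(1 + 1 / a\<^sup>2) * z\<^sup>2 = (z * d)\<^sup>2\<close>.\<close>

lemma norm_one_zero:
  assumes "(x1, x2, y, z) \<in> singular_vecs" "z \<noteq> 0" "z\<^sup>2 + a\<^sup>2 * x1 * x2 = 0"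
  shows "(y / (z * d)) * cj (y / (z * d)) = 1"
proof -
  have K: "cj z = z" "cj d = d"
    using assms(1) d by (auto simp: singular_vecs_iff in_K_iff)
  have "y * cj y = z\<^sup>2 - x1 * x2"
    using assms(1) by (simp add: singular_vecs_iff eq_diff_eq add.commute)
  then have "a\<^sup>2 * (y * cj y) = a\<^sup>2 * z\<^sup>2 - a\<^sup>2 * x1 * x2"
    by (simp add: right_diff_distrib mult.assoc)
  also have "\<dots> = (a\<^sup>2 + 1) * z\<^sup>2"
    using assms(3) by (simp add: algebra_simps eq_neg_iff_add_eq_0)
  also have "\<dots> = a\<^sup>2 * (z * d)\<^sup>2"
    by (simp add: ad[symmetric] power_mult_distrib add.commute)
  finally have "y * cj y = (z * d)\<^sup>2"
    using a by simp
  then show ?thesis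
    using K assms(2) d by (simp add: power2_eq_square)
qed

text \<open>The first clause sees only \<open>z\<^sup>2\<close> and \<open>x1 * x2\<close>. In the
  others both sides are multiplied by the sign \<open>eps w\<close>: the \<open>chi\<close> side
  through \<open>z\<close>, since \<open>chi e = e\<close> for a sign \<open>e\<close>, and the
  \<open>eps\<close> side through \<open>y\<close>.\<close>

lemma in_M_T_map:
  assumes v: "v \<in> singular_vecs" "in_M v" and \<beta>: "\<beta> \<in> K" "\<beta> \<noteq> 0" "chi \<beta> = 1" and w: "w * cj w = 1"
  shows "in_M (T_map q \<beta> w v)"
proof -
  obtain x1 x2 y z where v_eq: "v = (x1, x2, y, z)"
    by (cases v)
  define e where "e = eps w"
  have e: "e = 1 \<or> e = - 1"
    using eps_cases[OF w] by (simp add: e_def)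
  then have e2: "(e * z)\<^sup>2 = z\<^sup>2" "chi e = e" "eps e = 1" "e \<noteq> 0"
    by (auto simp: power_mult_distrib)
  have *: "a\<^sup>2 * (\<beta> * x1) * (inverse \<beta> * x2) = a\<^sup>2 * x1 * x2"
    using \<beta> by (simp add: field_simps)
  have T: "T_map q \<beta> w v = (\<beta> * x1, inverse \<beta> * x2, w * y, e * z)"
    by (simp add: v_eq e_def eps_def)
  have chis: "chi (\<beta> * x1 * (e * z)) = e * chi (x1 * z)"
    "chi (- (inverse \<beta> * x2 * (e * z))) = e * chi (- (x2 * z))"
    "chi (- (a * (\<beta> * x1) * (e * z))) = e * chi (- (a * x1 * z))"
    using \<beta> e2 by (simp_all add: chi_mult chi_inverse)
  have epss: "eps (w * y / (e * z)) = e * eps (y / z)"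
    "eps (w * y / (e * z * d)) = e * eps (y / (z * d))"
    using e2 by (simp_all add: eps_mult eps_divide e_def)
  show ?thesis
    using v(2) \<beta>(2) e2(4) unfolding T unfolding v_eq in_M.simps e2(1) * chis epss
    by (auto simp del: chi_minus)
qed

text \<open>The ratios become minus their conjugates, and \<open>eps\<close> ignores both changes on
  norm-one elements.\<close>

lemma in_M_sigma_map:
  assumes "v \<in> singular_vecs" "in_M v"
  shows "in_M (sigma_map q v)"
proof -
  obtain x1 x2 y z where v: "v = (x1, x2, y, z)"
    by (cases v)
  have "cj z = z" "cj d = d"
    using assms(1) d by (auto simp: v singular_vecs_iff in_K_iff)
  then have "- (y ^ q) / z = - cj (y / z)" "- (y ^ q) / (z * d) = - cj (y / (z * d))"
    by (simp_all flip: cj_def)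
  then have "eps (- (y ^ q) / z) = eps (cj (y / z))"
    "eps (- (y ^ q) / (z * d)) = eps (cj (y / (z * d)))"
    by (simp_all only: eps_minus)
  then show ?thesis
    using assms norm_one_axis[of x1 x2 y z] norm_one_zero[of x1 x2 y z] eps_cj
    unfolding v sigma_map.simps in_M.simps by metis
qed

lemma in_M_tau_map:
  assumes "v \<in> singular_vecs" "in_M v"
  shows "in_M (tau_map v)"
proof -
  obtain x1 x2 y z where v: "v = (x1, x2, y, z)"
    by (cases v)
  have K: "x1 \<in> K" "x2 \<in> K"
    using assms(1) by (auto simp: v singular_vecs_iff)
  \<comment> \<open>The product of \<open>a * x1 * z\<close> and \<open>a * x2 * z\<close> is
    \<open>- (z ^ 4)\<close>, a nonsquare, so their \<open>chi\<close> values are opposite; this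
    makes the last clause symmetric under exchanging \<open>x1\<close>, \<open>x2\<close> and
    negating \<open>z\<close>.\<close>
  have "chi (a * x2 * z) = chi (- (a * x1 * z))" if "z\<^sup>2 + a\<^sup>2 * x1 * x2 = 0" "z \<noteq> 0"
  proof -
    have z: "z \<in> K"
      using assms(1) by (auto simp: v singular_vecs_iff)
    have "(a * x1 * z) * (a * x2 * z) = (a\<^sup>2 * x1 * x2) * z\<^sup>2"
      by (simp add: power2_eq_square algebra_simps)
    also have "\<dots> = - ((z\<^sup>2)\<^sup>2)"
      using that(1) by (simp add: power2_eq_square eq_neg_iff_add_eq_0 add.commute distrib_right[symmetric])
    finally have "chi (a * x1 * z) * chi (a * x2 * z) = chi (- ((z\<^sup>2)\<^sup>2))"
      by (simp only: chi_mult[symmetric])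
    also have "\<dots> = - 1"
      using chi_square[of "z\<^sup>2"] z that(2) by simp
    finally have "chi (a * x1 * z) * chi (a * x2 * z) = - 1" .
    moreover have "x1 \<noteq> 0" "x2 \<noteq> 0"
      using that by auto
    ultimately show ?thesis
      using chi_cases[of "a * x1 * z"] chi_cases[of "a * x2 * z"] K z a that(2) by auto
  qed
  then show ?thesis
    using assms(2) unfolding v by (auto simp: mult_ac)
qed

section \<open>The union of orbits described in coordinates\<close>

definition M_pts :: "'a vec set set" where
  "M_pts = pt K ` {v \<in> singular_vecs. in_M v}"

lemma pt_in_M_pts_iff:
  assumes "v \<in> singular_vecs"
  shows "pt K v \<in> M_pts \<longleftrightarrow> in_M v"
proof
  assume "pt K v \<in> M_pts"
  then obtain u where u: "u \<in> singular_vecs" "in_M u" "pt K u = pt K v"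
    by (auto simp: M_pts_def)
  moreover have "v \<noteq> 0"
    using assms by (simp add: singular_vecs_def)
  ultimately obtain c where "c \<in> K" "c \<noteq> 0" "v = scale c u"
    using pt_eqD by metis
  then show "in_M v"
    using u in_M_scale by simp
next
  assume "in_M v"
  then show "pt K v \<in> M_pts"
    using assms by (auto simp: M_pts_def)
qed

lemma A_orbit_subset_M_pts:
  assumes "v \<in> singular_vecs" "in_M v"
  shows "A_orbit q K v \<subseteq> M_pts"
proof (rule A_orbit_subset)
  show "M_pts \<subseteq> PG_points K"
    by (auto simp: M_pts_def singular_vecs_def pt_in_PG_points)
  show "pt K v \<in> M_pts"
    using assms by (auto simp: M_pts_def)
  fix g P
  assume g: "g \<in> A_gens q K" and "P \<in> M_pts"
  then obtain u where u: "u \<in> singular_vecs" "in_M u" "P = pt K u"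
    by (auto simp: M_pts_def)
  then have V: "u \<in> V K" "u \<noteq> 0"
    by (auto simp: singular_vecs_def)
  from g show "g P \<in> M_pts"
  proof (cases rule: A_gens_cases)
    case (1 \<beta> w)
    then show ?thesis
      using V u by (simp add: proj_map_pt T_map_scale pt_in_M_pts_iff T_map_singular in_M_T_map)
  next
    case 2
    then show ?thesis
      using V u by (simp add: proj_map_pt sigma_map_scale pt_in_M_pts_iff sigma_map_singular in_M_sigma_map)
  next
    case 3
    then show ?thesis
      using V u by (simp add: proj_map_pt tau_map_scale pt_in_M_pts_iff tau_map_singular in_M_tau_map)
  qed
qed

lemma base_singular:
  "(1, 0, 1, 1) \<in> singular_vecs" "(1, 1, \<mu>, 0) \<in> singular_vecs" "(1, 1, 0, 1) \<in> singular_vecs"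
  "(- 1, 1, a * d, a) \<in> singular_vecs"
  using a d ad mu by (simp_all add: singular_vecs_iff in_K_iff power2_eq_square mult_ac)

lemma base_in_M:
  "in_M (1, 0, 1, 1)" "in_M (1, 1, \<mu>, 0)" "in_M (1, 1, 0, 1)" "in_M (- 1, 1, a * d, a)"
proof -
  \<comment> \<open>By \<open>ad\<close>, \<open>1 + a\<^sup>2\<close> is the square of
    \<open>a * d\<close>.\<close>
  have "chi (a\<^sup>2) = 1" "chi (1 + a\<^sup>2) = 1"
    using chi_square[of a] chi_square[of "a * d"] a d by (simp_all add: power_mult_distrib ad)
  then show "in_M (1, 0, 1, 1)" "in_M (1, 1, \<mu>, 0)" "in_M (1, 1, 0, 1)" "in_M (- 1, 1, a * d, a)"
    using a d by (simp_all flip: power2_eq_square)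
qed

lemma S_set_subset_M_pts: "S_set q K a \<subseteq> M_pts"
proof
  fix P assume "P \<in> S_set q K a"
  then obtain x1 x2 y where *: "P = pt K (x1, x2, y, 1)" "(x1, x2, y, 1) \<in> V K"
    "pt K (x1, x2, y, 1) \<in> Q_points q K" "nonzero_square K (1 + a\<^sup>2 * x1 * x2)" "x1 * x2 * y \<noteq> 0"
    by (auto simp: S_set_def)
  then have "(x1, x2, y, 1) \<in> singular_vecs"
    using pt_in_Q_points_iff by (simp add: zero_prod_def)
  moreover have "chi (1 + a\<^sup>2 * x1 * x2) = 1"
    using * a nonzero_square_iff by (simp add: V_def)
  ultimately show "P \<in> M_pts"
    using * by (simp add: pt_in_M_pts_iff)
qed

text \<open>Apart from the points of \<open>S_set\<close>, each case is solved explicitly for a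
  generator \<open>T_map\<close> and a scalar carrying the base vector, or its image under
  \<open>tau_map\<close>, to the given vector.\<close>

lemma in_M_orbit_case_affine:
  assumes "(x1, x2, y, 1) \<in> singular_vecs" "in_M (x1, x2, y, 1)"
  shows "pt K (x1, x2, y, 1) \<in> M_set q K a d \<mu>"
proof -
  let ?v = "(x1, x2, y, 1) :: 'a vec"
  have K: "x1 \<in> K" "x2 \<in> K" and f: "x1 * x2 + y * cj y = 1"
    using assms(1) by (simp_all add: singular_vecs_iff)
  consider (S) "x1 \<noteq> 0" "x2 \<noteq> 0" "y \<noteq> 0" "chi (1 + a\<^sup>2 * x1 * x2) = 1"
    | (y0) "x1 \<noteq> 0" "y = 0"
    | (x2) "x2 = 0" "chi x1 = eps y"
    | (x1) "x1 = 0" "chi (- x2) = eps y"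
    | (zero) "1 + a\<^sup>2 * x1 * x2 = 0" "chi (- (a * x1)) = eps (y / d)"
    using assms(2) by auto
  then show ?thesis
  proof cases
    case S
    then have "pt K ?v \<in> S_set q K a"
      using assms(1) K a unfolding S_set_def
      by (intro CollectI exI[of _ x1] exI[of _ x2] exI[of _ y])
        (simp add: nonzero_square_iff V_def pt_in_Q_points_iff zero_prod_def)
    then show ?thesis
      by (simp add: M_set_def)
  next
    case y0
    let ?u = "(1, 1, 0, 1) :: 'a vec"
    have x2: "x2 = inverse x1"
      using y0 f by (simp add: inverse_unique)
    have self: "pt K ?u \<in> A_orbit q K ?u"
      using base_singular(3) by (simp add: A_orbit_self singular_vecs_def)
    have "pt K ?v \<in> A_orbit q K ?u"
    proof (cases "chi x1 = 1")
      case True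
      have "?v = scale 1 (T_map q x1 1 ?u)"
        by (simp add: x2 y0)
      then show ?thesis
        using pt_in_T_orbit[OF base_singular(3) base_singular(3) self, of x1 1 1] True K by simp
    next
      case False
      \<comment> \<open>A nonsquare \<open>x1\<close> is reached through \<open>tau_map\<close>:
        this gives \<open>z = - 1\<close>, and rescaling by \<open>- 1\<close> lets the square
        \<open>- x1\<close> serve as \<open>\<beta>\<close>.\<close>
      then have chi: "chi (- x1) = 1"
        using chi_cases[of x1] K y0 by auto
      have "pt K (tau_map ?u) \<in> A_orbit q K ?u"
        using A_orbit_tau[OF _ _ _ _ self] base_singular(3) by (simp add: singular_vecs_def)
      moreover have "?v = scale (- 1) (T_map q (- x1) 1 (tau_map ?u))"
        by (simp add: x2 y0)
      ultimately show ?thesis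
        using pt_in_T_orbit[OF base_singular(3) tau_map_singular[OF base_singular(3)], of "- x1" 1 "- 1"]
          chi K by simp
    qed
    then show ?thesis
      by (simp add: M_set_def)
  next
    case x2
    let ?u = "(1, 0, 1, 1) :: 'a vec"
    define e where "e = eps y"
    have norm: "y * cj y = 1"
      using x2 f by simp
    then have e: "e = 1 \<or> e = - 1"
      using eps_cases by (simp add: e_def)
    have self: "pt K ?u \<in> A_orbit q K ?u"
      using base_singular(1) by (simp add: A_orbit_self singular_vecs_def)
    have "eps (e * y) = e"
      using e by (auto simp: e_def)
    \<comment> \<open>\<open>e * x1\<close> is a square because \<open>chi x1 = e\<close>;
      \<open>T_map\<close> then produces \<open>z = e\<close>, and the outer scalar \<open>e\<close>
      restores \<open>z = 1\<close>.\<close>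
    then have eq: "?v = scale e (T_map q (e * x1) (e * y) ?u)"
      using e x2 by (auto simp: eps_def)
    have "chi (e * x1) = 1" "e * y * cj (e * y) = 1" "e \<in> K" "e \<noteq> 0"
      using e x2 norm by (auto simp: e_def)
    then have "pt K ?v \<in> A_orbit q K ?u"
      unfolding eq using pt_in_T_orbit[OF base_singular(1) base_singular(1) self] K by simp
    then show ?thesis
      by (simp add: M_set_def)
  next
    case x1
    let ?u = "(1, 0, 1, 1) :: 'a vec"
    define e where "e = eps y"
    have norm: "y * cj y = 1"
      using x1 f by simp
    then have e: "e = 1 \<or> e = - 1"
      using eps_cases by (simp add: e_def)
    have self: "pt K ?u \<in> A_orbit q K ?u"
      using base_singular(1) by (simp add: A_orbit_self singular_vecs_def)
    have x2: "x2 \<noteq> 0"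
      using x1 e by (auto simp: e_def)
    have self': "pt K (tau_map ?u) \<in> A_orbit q K ?u"
      using A_orbit_tau[OF _ _ _ _ self] base_singular(1) by (simp add: singular_vecs_def)
    have "eps (- (e * y)) = e"
      using e by (auto simp: e_def)
    \<comment> \<open>The image of the base vector under \<open>tau_map\<close> is
      \<open>(0, 1, 1, - 1)\<close>, whence the extra minus signs.\<close>
    then have eq: "?v = scale (- e) (T_map q (- (e / x2)) (- (e * y)) (tau_map ?u))"
      using e x1 by (auto simp: eps_def)
    have "chi x2 = - e"
      using x1(2) by (metis chi_minus e_def minus_minus)
    then have "chi (- (e / x2)) = 1" "- (e * y) * cj (- (e * y)) = 1" "- e \<in> K" "e \<noteq> 0"
      using e norm by (auto simp: chi_divide)
    then have "pt K ?v \<in> A_orbit q K ?u"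
      unfolding eq
      by (intro pt_in_T_orbit base_singular(1) tau_map_singular self') (use K e in auto)
    then show ?thesis
      by (simp add: M_set_def)
  next
    case zero
    let ?u = "(- 1, 1, a * d, a) :: 'a vec"
    define e where "e = eps (y / d)"
    have norm: "(y / d) * cj (y / d) = 1"
      using norm_one_zero[OF assms(1)] zero by simp
    then have e: "e = 1 \<or> e = - 1"
      using eps_cases e_def by simp
    have self: "pt K ?u \<in> A_orbit q K ?u"
      using base_singular(4) by (simp add: A_orbit_self singular_vecs_def)
    have x1: "x1 \<noteq> 0"
      using zero by auto
    then have x2: "x2 = - (1 / (a\<^sup>2 * x1))"
      using zero(1) a by (simp add: field_simps eq_neg_iff_add_eq_0)
    have "eps (e * (y / d)) = e"
      using e by (auto simp: e_def)
    \<comment> \<open>As \<open>x2\<close> is determined by \<open>x1\<close>, only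
      \<open>x1\<close>, \<open>y\<close> and \<open>z\<close> have to be matched; the clause of
      \<open>in_M\<close> says exactly that \<open>- (a * e * x1)\<close> is a square.\<close>
    then have "?v = scale (e / a) (T_map q (- (a * e * x1)) (e * (y / d)) ?u)"
      using e a d x1 x2 by (auto simp: eps_def field_simps power2_eq_square)
    moreover have "chi (- (a * e * x1)) = 1" "e * (y / d) * cj (e * (y / d)) = 1" "e / a \<in> K" "e \<noteq> 0"
      using e zero norm a by (auto simp: e_def)
    ultimately have "pt K ?v \<in> A_orbit q K ?u"
      using pt_in_T_orbit[OF base_singular(4) base_singular(4) self,
          of "- (a * e * x1)" "e * (y / d)" "e / a"] K a e by auto
    then show ?thesis
      by (simp add: M_set_def)
  qed
qed

lemma in_M_orbit_case_infinity:
  assumes "(x1, x2, y, 0) \<in> singular_vecs" "in_M (x1, x2, y, 0)"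
  shows "pt K (x1, x2, y, 0) \<in> M_set q K a d \<mu>"
proof -
  let ?v = "(x1, x2, y, 0) :: 'a vec" and ?u = "(1, 1, \<mu>, 0) :: 'a vec"
  have K: "x1 \<in> K" "x2 \<in> K" and f: "x1 * x2 + y * cj y = 0"
    using assms(1) by (simp_all add: singular_vecs_iff)
  have nz: "x1 \<noteq> 0" "x2 \<noteq> 0" and "chi (a\<^sup>2 * (x1 * x2)) = 1"
    using assms(2) by (simp_all add: mult.assoc)
  then have "chi (x1 * x2) = 1"
    using chi_square[OF a] by (simp add: chi_mult)
  then obtain s where s: "s \<in> K" "s \<noteq> 0" "x1 * x2 = s\<^sup>2"
    using nonzero_square_iff[of "x1 * x2"] K by (auto simp: nonzero_square_def)
  \<comment> \<open>Since \<open>-1\<close> is a nonsquare, the sign of the root of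
    \<open>x1 * x2\<close> can be chosen so that \<open>x1 / t\<close> is a square and may serve as
    \<open>\<beta>\<close>.\<close>
  obtain t where t: "t \<in> K" "t \<noteq> 0" "x1 * x2 = t\<^sup>2" "chi (x1 / t) = 1"
  proof (cases "chi (x1 / s) = 1")
    case True
    then show ?thesis
      using s that by blast
  next
    case False
    then have "chi (x1 / s) = - 1"
      using chi_cases[of "x1 / s"] K s nz by auto
    then have "chi (x1 / (- s)) = 1"
      by (simp only: divide_minus_right chi_minus) simp
    then show ?thesis
      using s that[of "- s"] by simp
  qed
  have self: "pt K ?u \<in> A_orbit q K ?u"
    using base_singular(2) by (simp add: A_orbit_self singular_vecs_def)
  have mu0: "\<mu> \<noteq> 0"
    using mu by auto
  have "y * cj y = - (t\<^sup>2)"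
    using f t by (simp add: eq_neg_iff_add_eq_0 add.commute)
  then have norm: "y / (t * \<mu>) * cj (y / (t * \<mu>)) = 1"
    using mu t mu0 by (simp add: in_K_iff power2_eq_square)
  have "x2 = t * (t / x1)"
    using t nz by (simp add: field_simps power2_eq_square)
  then have "?v = scale t (T_map q (x1 / t) (y / (t * \<mu>)) ?u)"
    using t mu0 by simp
  then have "pt K ?v \<in> A_orbit q K ?u"
    using pt_in_T_orbit[OF base_singular(2) base_singular(2) self, of "x1 / t" "y / (t * \<mu>)" t]
      K t norm by simp
  then show ?thesis
    by (simp add: M_set_def)
qed

lemma M_set_eq_M_pts: "M_set q K a d \<mu> = M_pts"
proof
  show "M_set q K a d \<mu> \<subseteq> M_pts"
    using S_set_subset_M_pts A_orbit_subset_M_pts base_singular base_in_M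
    by (simp add: M_set_def)
  show "M_pts \<subseteq> M_set q K a d \<mu>"
  proof
    fix P assume "P \<in> M_pts"
    then obtain x1 x2 y z where v: "P = pt K (x1, x2, y, z)" "(x1, x2, y, z) \<in> singular_vecs"
      "in_M (x1, x2, y, z)"
      by (auto simp: M_pts_def)
    show "P \<in> M_set q K a d \<mu>"
    proof (cases "z = 0")
      case True
      then show ?thesis
        using v in_M_orbit_case_infinity by simp
    next
      case False
      have z: "z \<in> K" "1 / z \<in> K"
        using v(2) by (simp_all add: singular_vecs_iff)
      have "scale (1 / z) (x1, x2, y, z) = (x1 / z, x2 / z, y / z, 1)"
        using False by simp
      then show ?thesis
        using v z False in_M_orbit_case_affine[of "x1 / z" "x2 / z" "y / z"]
          singular_vecs_scale[OF z(2) _ v(2)] in_M_scale[OF z(2), of "(x1, x2, y, z)"]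
          pt_scale[OF z(2), of "(x1, x2, y, z)"]
        by simp
    qed
  qed
qed

section \<open>Counting on lines\<close>

lemma card_chi_eq:
  assumes "e = 1 \<or> e = - 1"
  shows "card {x\<in>K. chi x = e} = (q - 1) div 2"
proof -
  have "2 * card {x\<in>K-{0}. chi x = e} = card (K - {0})"
  proof (rule card_half_of_swap[where f = uminus])
    fix x assume "x \<in> K - {0}"
    then show "chi (- x) = e \<longleftrightarrow> \<not> chi x = e"
      using chi_cases[of x] assms by auto
  qed auto
  moreover have "{x\<in>K-{0}. chi x = e} = {x\<in>K. chi x = e}"
    using assms by auto
  ultimately show ?thesis
    by (simp add: card_nonzero_K)
qed

text \<open>Membership amounts to a prescribed sign of \<open>chi x\<close>, which excludes
  \<open>x = 0\<close>. The remaining point of the line has \<open>z = 0\<close> and lies outside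
  the set.\<close>

lemma count_on_axis_line:
  assumes "w * cj w = 1"
  shows "card {x\<in>K. in_M (x, 0, w, 1)} = (q - 1) div 2"
    and "card {x\<in>K. in_M (0, x, w, 1)} = (q - 1) div 2"
proof -
  have e: "eps w = 1 \<or> eps w = - 1" "- eps w = 1 \<or> - eps w = - 1"
    using eps_cases[OF assms] by auto
  have "{x\<in>K. in_M (x, 0, w, 1)} = {x\<in>K. chi x = eps w}"
    using e by auto
  then show "card {x\<in>K. in_M (x, 0, w, 1)} = (q - 1) div 2"
    using card_chi_eq[OF e(1)] by simp
  have "in_M (0, x, w, 1) \<longleftrightarrow> chi (- x) = eps w" for x
    using e(1) by auto
  moreover have "chi (- x) = eps w \<longleftrightarrow> chi x = - eps w" for x
    by (metis chi_minus minus_minus)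
  ultimately have "{x\<in>K. in_M (0, x, w, 1)} = {x\<in>K. chi x = - eps w}"
    by (simp only:)
  then show "card {x\<in>K. in_M (0, x, w, 1)} = (q - 1) div 2"
    using card_chi_eq[OF e(2)] by simp
qed

text \<open>The line joins \<open>(0, 0, w, 1)\<close>, outside the set, to
  \<open>(1, c, y, 0)\<close>; the hypotheses \<open>y\<close> and \<open>orth\<close> say that the
  second vector is singular and orthogonal to the first. The zeros of
  \<open>x\<^sup>2 + a\<^sup>2 * c\<close> are paired by negation.\<close>

lemma count_on_line_through_conic:
  assumes w: "w * cj w = 1" and c: "c \<in> K" "c \<noteq> 0" and y: "c + y * cj y = 0"
    and orth: "y * cj w + w * cj y = 0"
  shows "card {x\<in>K. in_M (1, c, y + x * w, x)} = (q - 1) div 2"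
proof -
  define Z where "Z = {x\<in>K. x\<^sup>2 + a\<^sup>2 * c = 0}"
  define S where "S = {x\<in>K. chi (x\<^sup>2 + a\<^sup>2 * c) = 1}"
  define cond where "cond x \<longleftrightarrow> chi (- (a * x)) = eps ((y + x * w) / (x * d))" for x
  have w0: "w \<noteq> 0" and cj_w: "cj w = 1 / w"
    using w by (auto simp: eq_divide_eq mult.commute)
  have Z_nz: "x \<noteq> 0" if "x \<in> Z" for x
    using that a c by (auto simp: Z_def)
  have "y + w\<^sup>2 * cj y = w * (y * cj w + w * cj y)"
    using cj_w w0 by (simp add: power2_eq_square algebra_simps)
  then have cj_y: "w\<^sup>2 * cj y = - y"
    using orth by (simp add: eq_neg_iff_add_eq_0 add.commute)
  have "0 \<noteq> a\<^sup>2 * c"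
    using a c by simp
  then have count: "2 * card S + card Z = q - 1"
    using count_monic_quadratic[of 0 "a\<^sup>2 * c"] a c by (simp add: S_def Z_def)
  have "2 * card {x\<in>Z. cond x} = card Z"
  proof (rule card_half_of_swap[where f = uminus])
    fix x assume x: "x \<in> Z"
    then have "x \<in> K" and x0: "x \<noteq> 0"
      using Z_nz[OF x] by (simp_all add: Z_def)
    then have xK: "x \<in> K" "cj x = x"
      using in_K_iff by simp_all
    define \<omega> where "\<omega> = (y + x * w) / (x * d)"
    have "y * cj (x * w) + x * w * cj y = x * (y * cj w + w * cj y)"
      using xK by (simp add: algebra_simps)
    moreover have "x * w * cj (x * w) = x\<^sup>2 * (w * cj w)"
      using xK(2) by (simp add: power2_eq_square mult_ac)
    moreover have "c + (y + x * w) * cj (y + x * w) =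
        (c + y * cj y) + (y * cj (x * w) + x * w * cj y) + x * w * cj (x * w)"
      by (simp add: algebra_simps)
    ultimately have "c + (y + x * w) * cj (y + x * w) = x\<^sup>2"
      using y orth w by simp
    then have "(1, c, y + x * w, x) \<in> singular_vecs"
      using c xK by (simp add: singular_vecs_iff)
    then have norm: "\<omega> * cj \<omega> = 1"
      using norm_one_zero[of 1 c "y + x * w" x] x x0 by (simp add: \<omega>_def Z_def)
    \<comment> \<open>Passing from \<open>x\<close> to \<open>- x\<close> replaces
      \<open>\<omega>\<close> by \<open>w\<^sup>2 * cj \<omega>\<close>, which has the same
      \<open>eps\<close>, while the argument of \<open>chi\<close> changes sign.\<close>
    have "w\<^sup>2 * cj \<omega> = (w\<^sup>2 * cj y + w * x) / (x * d)"
      using xK d w0 by (simp add: \<omega>_def in_K_iff cj_w power2_eq_square distrib_left)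
    also have "\<dots> = (y + - x * w) / (- x * d)"
      by (simp add: cj_y flip: minus_divide_left minus_divide_right) (simp add: minus_divide_left algebra_simps)
    finally have "eps ((y + - x * w) / (- x * d)) = eps (w\<^sup>2 * cj \<omega>)"
      by simp
    also have "\<dots> = eps \<omega>"
      using eps_cases[OF w] eps_cj[OF norm] by (auto simp: eps_mult eps_power)
    finally show "cond (- x) \<longleftrightarrow> \<not> cond x"
      using chi_cases[of "a * x"] eps_cases[OF norm] a xK x0
      unfolding cond_def \<omega>_def[symmetric] by auto
  qed (auto simp: Z_def)
  moreover have "{x\<in>K. in_M (1, c, y + x * w, x)} = S \<union> {x\<in>Z. cond x}"
  proof -
    have "in_M (1, c, y + x * w, x) \<longleftrightarrow> x \<in> S \<or> x \<in> Z \<and> cond x" if "x \<in> K" for x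
    proof (cases "x = 0")
      case True
      then show ?thesis
        using that Z_nz[of x] c by (auto simp: S_def)
    next
      case False
      then show ?thesis
        using that c by (simp add: S_def Z_def cond_def)
    qed
    then show ?thesis
      by (auto simp: S_def Z_def)
  qed
  moreover have "S \<inter> {x\<in>Z. cond x} = {}"
    by (auto simp: S_def Z_def)
  ultimately show ?thesis
    using count by (simp add: card_Un_disjoint)
qed

text \<open>The line joins \<open>(0, b, w1, 1)\<close> to \<open>(c, 0, w2, 1)\<close>, and
  \<open>sing\<close> is singularity of their sum, whose last coordinate is 2. The \<open>if\<close>
  counts the first point; \<open>x = 0\<close> is the second.\<close>

lemma count_on_general_line:
  assumes w: "w1 * cj w1 = 1" "w2 * cj w2 = 1" and bc: "b \<in> K" "b \<noteq> 0" "c \<in> K" "c \<noteq> 0"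
    and sing: "c * b + (w2 + w1) * cj (w2 + w1) = 4"
  shows "(if in_M (0, b, w1, 1) then 1 else 0)
    + card {x\<in>K. in_M (c, x * b, w2 + x * w1, 1 + x)} = (q - 1) div 2"
proof -
  define e where "e = b * c"
  \<comment> \<open>\<open>u\<close> has norm one and \<open>e = 2 - u - cj u\<close>, so
    \<open>chi e = eps w1 * eps w2\<close>; this governs both the end points and the pairing of
    zeros.\<close>
  define u where "u = w1 * cj w2"
  define B where "B = 1 + a\<^sup>2 * e / 2"
  define G where "G x = x\<^sup>2 + 2 * B * x + 1" for x
  define Z where "Z = {x\<in>K. G x = 0}"
  define S where "S = {x\<in>K. chi (G x) = 1}"
  define cond where "cond x \<longleftrightarrow> chi (- (a * c * (1 + x))) = eps ((w2 + x * w1) / ((1 + x) * d))" for x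
  have w0: "w1 \<noteq> 0" "w2 \<noteq> 0" and cj_w: "cj w1 = 1 / w1" "cj w2 = 1 / w2"
    using w by (auto simp: eq_divide_eq mult.commute)
  have e: "e \<in> K" "e \<noteq> 0"
    using bc by (auto simp: e_def)
  have trace: "e = 2 - u - cj u"
  proof -
    have "(w2 + w1) * cj (w2 + w1) = w1 * cj w1 + w2 * cj w2 + u + cj u"
      by (simp add: u_def algebra_simps)
    then show ?thesis
      using sing w by (simp add: e_def algebra_simps)
  qed
  have norm_u: "u * cj u = 1"
    using w0 cj_w by (simp add: u_def)
  have "u \<noteq> 1"
    using trace e by auto
  have eps_u: "eps u = eps w1 * eps w2"
    using eps_cj[OF w(2)] by (simp add: u_def eps_mult)
  have chi_e: "chi e = eps w1 * eps w2"
    using chi_two_minus_trace[OF norm_u \<open>u \<noteq> 1\<close>] eps_u trace by simp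
  have B2: "2 * B = 2 + a\<^sup>2 * e"
    by (simp add: B_def distrib_left)
  have G_eq: "(1 + x)\<^sup>2 + a\<^sup>2 * c * (x * b) = G x" for x
    unfolding G_def B2 by (simp add: e_def power2_eq_square algebra_simps)
  have G_eq': "G x = (1 + x)\<^sup>2 + a\<^sup>2 * e * x" for x
    unfolding G_def B2 by (simp add: power2_eq_square algebra_simps)
  have Z_nz: "x \<noteq> 0" "1 + x \<noteq> 0" if "x \<in> Z" for x
  proof -
    show "x \<noteq> 0"
      using that by (auto simp: Z_def G_def)
    then show "1 + x \<noteq> 0"
      using that a e by (auto simp: Z_def G_eq')
  qed
  \<comment> \<open>As \<open>e\<close> is nonzero, a vanishing discriminant means
    \<open>a\<^sup>2 * e = - 4\<close>. Then \<open>a\<^sup>2 * (u - cj u)\<close> squares to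
    \<open>16 * (1 + a\<^sup>2) = (4 * a * d)\<^sup>2\<close>, so it is a nonzero element of
    \<open>K\<close>, yet conjugation negates it.\<close>
  have "B\<^sup>2 \<noteq> 1"
  proof
    assume "B\<^sup>2 = 1"
    then have "B = 1 \<or> B = - 1"
      by (simp add: power2_eq_1_iff)
    moreover have "2 * B \<noteq> 2 * 1"
      unfolding B2 using a e by simp
    ultimately have "2 * B = 2 * (- 1)"
      by auto
    then have ae: "a\<^sup>2 * (u + cj u) = 2 * a\<^sup>2 + 4"
      unfolding B2 trace by (simp add: algebra_simps eq_neg_iff_add_eq_0)
    define t where "t = a\<^sup>2 * (u - cj u)"
    have "t\<^sup>2 = (a\<^sup>2 * (u + cj u))\<^sup>2 - 4 * (a\<^sup>2)\<^sup>2 * (u * cj u)"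
      by (simp add: t_def power2_eq_square algebra_simps)
    also have "\<dots> = 16 * (1 + a\<^sup>2)"
      unfolding ae norm_u by (simp add: power2_eq_square algebra_simps)
    also have "\<dots> = (4 * a * d)\<^sup>2"
      by (simp add: power_mult_distrib ad[symmetric] mult.assoc)
    finally have "t = 4 * a * d \<or> t = - (4 * a * d)"
      by (simp add: power2_eq_iff)
    then have "cj t = t" "t \<noteq> 0"
      using a d by (auto simp: in_K_iff)
    moreover have "cj t = - t"
      using a by (simp add: t_def in_K_iff algebra_simps)
    ultimately show False
      by simp
  qed
  moreover have "B \<in> K"
    using a e by (simp add: B_def)
  ultimately have count: "2 * card S + card Z = q - 1"
    using count_monic_quadratic[of B 1] by (simp add: S_def Z_def G_def)
  \<comment> \<open>\<open>G\<close> has constant term 1, so inversion permutes its zeros.\<close>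
  have half: "2 * card {x\<in>Z. cond x} = card Z"
  proof (rule card_half_of_swap[where f = inverse])
    fix x assume x: "x \<in> Z"
    then have "x \<in> K" and x0: "x \<noteq> 0" "1 + x \<noteq> 0" and Gx: "G x = 0"
      using Z_nz[OF x] by (simp_all add: Z_def)
    then have xK: "x \<in> K" "cj x = x"
      using in_K_iff by simp_all
    have "x\<^sup>2 * G (inverse x) = G x"
      using x0 by (simp add: G_def power2_eq_square field_simps)
    then show "inverse x \<in> Z"
      using Gx xK x0 by (simp add: Z_def)
    define \<omega> where "\<omega> = (w2 + x * w1) / ((1 + x) * d)"
    have "c * (x * b) + (w2 + x * w1) * cj (w2 + x * w1) =
        x * (e + u + cj u) + w2 * cj w2 + x\<^sup>2 * (w1 * cj w1)"
      using xK by (simp add: e_def u_def power2_eq_square algebra_simps)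
    also have "\<dots> = (1 + x)\<^sup>2"
      unfolding trace w by (simp add: power2_eq_square algebra_simps)
    finally have "(c, x * b, w2 + x * w1, 1 + x) \<in> singular_vecs"
      using bc xK by (simp add: singular_vecs_iff)
    then have norm: "\<omega> * cj \<omega> = 1"
      using norm_one_zero[of c "x * b" "w2 + x * w1" "1 + x"] x0 Gx G_eq by (simp add: \<omega>_def)
    have "w1 * w2 * cj \<omega> = (w1 * w2 * (1 / w2 + x / w1)) / ((1 + x) * d)"
      using xK(2) d by (simp add: \<omega>_def in_K_iff cj_w)
    also have "w1 * w2 * (1 / w2 + x / w1) = w1 + x * w2"
      using w0 by (simp add: field_simps)
    also have "(w1 + x * w2) / ((1 + x) * d) = (x * (w2 + inverse x * w1)) / (x * ((1 + inverse x) * d))"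
      using x0 by (simp add: algebra_simps)
    also have "\<dots> = (w2 + inverse x * w1) / ((1 + inverse x) * d)"
      using x0 by simp
    finally have "eps ((w2 + inverse x * w1) / ((1 + inverse x) * d)) = eps (w1 * w2 * cj \<omega>)"
      by simp
    then have eps_inv: "eps ((w2 + inverse x * w1) / ((1 + inverse x) * d)) = eps w1 * eps w2 * eps \<omega>"
      using eps_cj[OF norm] by (simp add: eps_mult)
    \<comment> \<open>Inversion changes the \<open>eps\<close> side by
      \<open>eps w1 * eps w2\<close> and the \<open>chi\<close> side by \<open>chi x\<close>. At a
      zero of \<open>G\<close> these two signs are opposite.\<close>
    have "a\<^sup>2 * (e * x) = - ((1 + x)\<^sup>2)"
      using Gx by (simp add: G_eq' eq_neg_iff_add_eq_0 mult.assoc add.commute)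
    then have "chi (a\<^sup>2 * (e * x)) = - 1"
      using chi_square[of "1 + x"] xK x0 by simp
    then have "chi e * chi x = - 1"
      using chi_square[of a] a by (simp add: chi_mult)
    then have chi_x: "chi x = - (eps w1 * eps w2)"
      using eps_cases[OF w(1)] eps_cases[OF w(2)] by (auto simp: chi_e)
    have "- (a * c * (1 + inverse x)) = - (a * c * (1 + x)) / x"
      using x0 by (simp add: field_simps)
    then have "chi (- (a * c * (1 + inverse x))) = chi (- (a * c * (1 + x))) / chi x"
      by (simp only: chi_divide)
    then show "cond (inverse x) \<longleftrightarrow> \<not> cond x"
      using eps_cases[OF w(1)] eps_cases[OF w(2)] eps_cases[OF norm]
        chi_cases[of "- (a * c * (1 + x))"] a bc xK x0
      unfolding cond_def eps_inv chi_x \<omega>_def[symmetric] by (auto simp del: chi_minus)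
  qed (auto simp: Z_def)
  have "chi b * chi c = chi e"
    by (simp add: e_def chi_mult)
  \<comment> \<open>The products \<open>chi b * chi c\<close> and \<open>eps w1 * eps w2\<close>
    agree, so the minus sign in the clause for \<open>x1 = 0\<close> makes exactly one end point
    belong to the set.\<close>
  then have ends: "in_M (0, b, w1, 1) \<longleftrightarrow> chi c \<noteq> eps w2"
    using bc chi_cases[of b] chi_cases[of c] eps_cases[OF w(1)] eps_cases[OF w(2)]
    by (auto simp: chi_e)
  let ?E = "if chi c = eps w2 then {0} else {}"
  \<comment> \<open>\<open>G 0 = 1\<close> puts 0 into \<open>S\<close>, but the first clause of
    \<open>in_M\<close> rejects it because \<open>x2 = 0\<close> there. The one end point in the set
    makes up for this loss.\<close>
  have "0 \<in> S" "finite S"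
    by (auto simp: S_def G_def)
  then have card_S: "card S = Suc (card (S - {0}))"
    by (metis card_Suc_Diff1)
  have "{x\<in>K. in_M (c, x * b, w2 + x * w1, 1 + x)} = (S - {0}) \<union> ({x\<in>Z. cond x} \<union> ?E)"
  proof -
    have "in_M (c, x * b, w2 + x * w1, 1 + x) \<longleftrightarrow>
        x \<noteq> 0 \<and> chi (G x) = 1 \<or> x = 0 \<and> chi c = eps w2 \<or> G x = 0 \<and> cond x" if "x \<in> K" for x
    proof (cases "x = 0")
      case True
      then show ?thesis
        using bc by (simp add: G_def)
    next
      case False
      then have "in_M (c, x * b, w2 + x * w1, 1 + x) \<longleftrightarrow> chi (G x) = 1 \<or> 1 + x \<noteq> 0 \<and> G x = 0 \<and> cond x"
        using bc by (simp add: G_eq cond_def)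
      then show ?thesis
        using False Z_nz(2)[of x] that by (auto simp: Z_def)
    qed
    then show ?thesis
      by (auto simp: S_def Z_def)
  qed
  moreover have "(S - {0}) \<inter> ({x\<in>Z. cond x} \<union> ?E) = {}" "{x\<in>Z. cond x} \<inter> ?E = {}"
    using Z_nz(1)[of 0] by (auto simp: S_def Z_def)
  ultimately have "card {x\<in>K. in_M (c, x * b, w2 + x * w1, 1 + x)} =
      card (S - {0}) + (card {x\<in>Z. cond x} + card ?E)"
    by (simp add: card_Un_disjoint)
  then show ?thesis
    using count half card_S by (cases "chi c = eps w2") (simp_all add: ends del: in_M.simps)
qed

section \<open>From the counts to arbitrary lines of the quadric\<close>

text \<open>\<open>p\<close> and \<open>r\<close> span \<open>W\<close>, so each point other than
  \<open>pt K p\<close> has exactly one representative \<open>r + scale x p\<close>.\<close>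

lemma card_M_pts_line:
  assumes W: "singular_plane W" and p: "p \<in> W" and r: "r \<in> W" and indep: "lin_indep2 K p r"
  shows "card (M_pts \<inter> {P \<in> PG_points K. P \<subseteq> W}) =
    (if in_M p then 1 else 0) + card {x\<in>K. in_M (r + scale x p)}"
proof -
  have "span2 K p r \<subseteq> W"
    using W p r by (auto simp: span2_def singular_plane_def)
  then have W_eq: "span2 K p r = W"
    using W card_span2[OF indep] by (intro card_subset_eq) (auto simp: singular_plane_def)
  have p0: "p \<noteq> 0"
    using indep K_closed(1,2) unfolding lin_indep2_def by (metis add.right_neutral scale_simps(2,3) zero_neq_one)
  have rp0: "r + scale x p \<noteq> 0" if "x \<in> K" for x
  proof
    assume "r + scale x p = 0"
    then have "scale x p + scale 1 r = 0"
      by (simp add: add.commute)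
    then show False
      using indep K_closed(2) that unfolding lin_indep2_def by (metis zero_neq_one)
  qed
  have sing: "w \<in> singular_vecs" if "w \<in> W" "w \<noteq> 0" for w
    using that W by (auto simp: singular_plane_def singular_vecs_def)
  have rpW: "r + scale x p \<in> W" if "x \<in> K" for x
    using that W p r by (simp add: singular_plane_def)
  let ?A = "{x\<in>K. in_M (r + scale x p)}"
  let ?E = "if in_M p then {pt K p} else {}"
  have "M_pts \<inter> {P \<in> PG_points K. P \<subseteq> W} = pt K ` {w\<in>W. w \<noteq> 0 \<and> in_M w}"
  proof safe
    fix P assume "P \<in> M_pts" "P \<subseteq> W"
    then obtain w where "w \<in> singular_vecs" "in_M w" "P = pt K w"
      by (auto simp: M_pts_def)
    then show "P \<in> pt K ` {w\<in>W. w \<noteq> 0 \<and> in_M w}"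
      using \<open>P \<subseteq> W\<close> self_in_pt[of w] by (auto simp: singular_vecs_def)
  next
    fix w assume w: "w \<in> W" "w \<noteq> 0" "in_M w"
    then show "pt K w \<in> M_pts"
      using sing by (simp add: M_pts_def)
    show "pt K w \<in> PG_points K"
      using w W by (auto simp: singular_plane_def pt_in_PG_points)
  next
    fix w v assume "w \<in> W" "v \<in> pt K w"
    then show "v \<in> W"
      using W by (auto simp: pt_def singular_plane_def)
  qed
  also have "\<dots> = ?E \<union> (\<lambda>x. pt K (r + scale x p)) ` ?A"
  proof safe
    fix w assume w: "w \<in> W" "w \<noteq> 0" "in_M w" and not_im: "pt K w \<notin> (\<lambda>x. pt K (r + scale x p)) ` ?A"
    obtain b c where bc: "b \<in> K" "c \<in> K" "w = scale b p + scale c r"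
      using w(1) unfolding W_eq[symmetric] span2_def by blast
    have "c = 0"
    proof (rule ccontr)
      assume c: "c \<noteq> 0"
      have w_eq: "w = scale c (r + scale (b / c) p)"
        using c bc by (simp add: scale_add_right add.commute)
      then have "pt K w = pt K (r + scale (b / c) p)" "in_M (r + scale (b / c) p)"
        using c bc(2) w(3) pt_scale in_M_scale by metis+
      moreover have "b / c \<in> K"
        using bc by simp
      ultimately show False
        using not_im by blast
    qed
    then have "w = scale b p" "b \<noteq> 0"
      using bc w(2) by auto
    then have "pt K w = pt K p" "in_M p"
      using bc w(3) pt_scale in_M_scale by metis+
    then show "pt K w \<in> ?E"
      by simp
  next
    fix P assume "P \<in> ?E"
    then show "P \<in> pt K ` {w\<in>W. w \<noteq> 0 \<and> in_M w}"
      using p p0 by (auto split: if_splits)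
  next
    fix x assume "x \<in> K" "in_M (r + scale x p)"
    then show "pt K (r + scale x p) \<in> pt K ` {w\<in>W. w \<noteq> 0 \<and> in_M w}"
      using rpW rp0 by blast
  qed
  also have "card \<dots> = card ?E + card ((\<lambda>x. pt K (r + scale x p)) ` ?A)"
  proof (rule card_Un_disjoint)
    have "pt K (r + scale x p) \<noteq> pt K p" if x: "x \<in> K" for x
    proof
      assume "pt K (r + scale x p) = pt K p"
      then obtain c where c: "c \<in> K" "c \<noteq> 0" "p = scale c (r + scale x p)"
        using pt_eqD p0 by metis
      have "scale (c * x - 1) p + scale c r = 0"
        using arg_cong[OF c(3), of "\<lambda>v. v + scale (- 1) p"]
        by (cases p; cases r) (simp add: zero_prod_def algebra_simps)
      then show False
        using indep c(1,2) x K_closed(2,8,9) unfolding lin_indep2_def by metis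
    qed
    then show "?E \<inter> (\<lambda>x. pt K (r + scale x p)) ` ?A = {}"
      by (auto split: if_splits)
  qed auto
  also have "card ((\<lambda>x. pt K (r + scale x p)) ` ?A) = card ?A"
  proof (intro card_image inj_onI)
    fix x x' assume "x \<in> ?A" "x' \<in> ?A" and eq: "pt K (r + scale x p) = pt K (r + scale x' p)"
    then have x: "x \<in> K" "x' \<in> K"
      by auto
    obtain c where c: "c \<in> K" "r + scale x' p = scale c (r + scale x p)"
      using pt_eqD[OF eq rp0[OF x(2)]] by metis
    have "scale (c * x - x') p + scale (c - 1) r = 0"
      using arg_cong[OF c(2), of "\<lambda>v. v + scale (- 1) (r + scale x' p)"]
      by (cases p; cases r) (simp add: zero_prod_def algebra_simps)
    then have "c * x - x' = 0 \<and> c - 1 = 0"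
      using indep c(1) x K_closed(2,8,9) unfolding lin_indep2_def by metis
    then show "x = x'"
      by auto
  qed
  finally show ?thesis
    by simp
qed

text \<open>A basis of \<open>W\<close> is brought into one of three shapes, according to whether
  \<open>x1\<close> or \<open>x2\<close> vanishes on \<open>W\<close> and, if neither does, whether
  the vector with \<open>x1 = 0\<close> also has \<open>x2 = 0\<close>.\<close>

lemma card_M_pts_singular_plane:
  assumes W: "singular_plane W"
  shows "card (M_pts \<inter> {P \<in> PG_points K. P \<subseteq> W}) = (q - 1) div 2"
proof -
  have fin: "card W = q\<^sup>2"
    using W by (simp add: singular_plane_def)
  have scale: "(c * x1, c * x2, c * y, c * z) \<in> W" if "(x1, x2, y, z) \<in> W" "c \<in> K" for c x1 x2 y z
    using singular_plane_comb[OF W that(1) that(1) that(2), of 0] by simp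
  have axis: ?thesis if ax: "(\<forall>v\<in>W. fst v = 0) \<or> (\<forall>v\<in>W. fst (snd v) = 0)"
  proof -
    obtain p1 p2 y where p: "(p1, p2, y, 0) \<in> W" "(p1, p2, y, 0) \<noteq> (0, 0, 0, 0)"
      using singular_plane_kernel_coords[OF W] by metis
    have py: "p1 * p2 = 0" "p1 \<in> K" "p2 \<in> K"
      using ax p(1) singular_plane_mem[OF W p(1)] by auto
    then have "y = 0"
      using singular_plane_mem(4)[OF W p(1)] by auto
    \<comment> \<open>\<open>N\<close> consists of the multiples of the vector with
      \<open>z = 0\<close>; by cardinality \<open>W\<close> has a vector outside it.\<close>
    define N where "N = (\<lambda>x::'a. if p1 = 0 then (0, x, 0, 0) else (x, 0, 0, 0) :: 'a vec) ` K"
    have "\<not> W \<subseteq> N"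
    proof
      assume "W \<subseteq> N"
      then have "card W \<le> card K"
        unfolding N_def by (rule surj_card_le[rotated]) simp
      then show False
        using fin q_ge_3 by (simp add: card_K power2_eq_square)
    qed
    then obtain r where "r \<in> W" "r \<notin> N"
      by blast
    then obtain r1 r2 w z where r: "(r1, r2, w, z) \<in> W" and r_notin: "(r1, r2, w, z) \<notin> N"
      by (cases r) simp
    note rK = singular_plane_mem[OF W r]
    have ax': "(p1 = 0 \<and> r1 = 0 \<and> p2 \<noteq> 0) \<or> (p1 \<noteq> 0 \<and> p2 = 0 \<and> r2 = 0)"
    proof -
      have "p1 = 0 \<and> r1 = 0 \<or> p2 = 0 \<and> r2 = 0"
        using ax p(1) r by (metis fst_conv snd_conv)
      moreover have "p1 \<noteq> 0 \<or> p2 \<noteq> 0"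
        using p(2) \<open>y = 0\<close> by simp
      ultimately show ?thesis
        by blast
    qed
    have z: "z \<noteq> 0"
    proof
      assume "z = 0"
      then have "w = 0"
        using rK(4) ax' by auto
      then show False
        using r_notin[unfolded N_def] \<open>z = 0\<close> ax' rK(1,2) by auto
    qed
    have norm: "w / z * cj (w / z) = 1"
      using rK ax' z by (auto simp: in_K_iff power2_eq_square)
    from ax' show ?thesis
    proof (elim disjE conjE)
      assume *: "p1 = 0" "r1 = 0" "p2 \<noteq> 0"
      have P: "(0, 1, 0, 0) \<in> W"
        using scale[of p1 p2 y 0 "1 / p2"] p(1) py * \<open>y = 0\<close> by simp
      have R: "(0, 0, w / z, 1) \<in> W"
        using singular_plane_comb[OF W r P, of "1 / z" "- (r2 / z)"] rK z * by simp
      have "lin_indep2 K (0, 1, 0, 0) (0, 0, w / z, 1)"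
        by (simp add: lin_indep2_def zero_prod_def)
      then show ?thesis
        using card_M_pts_line[OF W P R] count_on_axis_line(2)[OF norm] by simp
    next
      assume *: "p1 \<noteq> 0" "p2 = 0" "r2 = 0"
      have P: "(1, 0, 0, 0) \<in> W"
        using scale[of p1 p2 y 0 "1 / p1"] p(1) py * \<open>y = 0\<close> by simp
      have R: "(0, 0, w / z, 1) \<in> W"
        using singular_plane_comb[OF W r P, of "1 / z" "- (r1 / z)"] rK z * by simp
      have "lin_indep2 K (1, 0, 0, 0) (0, 0, w / z, 1)"
        by (simp add: lin_indep2_def zero_prod_def)
      then show ?thesis
        using card_M_pts_line[OF W P R] count_on_axis_line(1)[OF norm] by simp
    qed
  qed
  show ?thesis
  proof (cases "(\<forall>v\<in>W. fst v = 0) \<or> (\<forall>v\<in>W. fst (snd v) = 0)")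
    case True
    then show ?thesis
      by (rule axis)
  next
    case False
    then obtain r1 r2 ry rz s1 s2 sy sz where r: "(r1, r2, ry, rz) \<in> W" "r1 \<noteq> 0"
      and s: "(s1, s2, sy, sz) \<in> W" "s2 \<noteq> 0"
      by (metis prod_cases4 fst_conv snd_conv)
    note rK = singular_plane_mem[OF W r(1)] and sK = singular_plane_mem[OF W s(1)]
    obtain p2 y z where pW: "(0, p2, y, z) \<in> W" and p0: "(0, p2, y, z) \<noteq> (0, 0, 0, 0)"
      using singular_plane_kernel_coords[OF W] by metis
    note pK = singular_plane_mem[OF W pW]
    have norm_p: "y / z * cj (y / z) = 1" if "z \<noteq> 0"
      using pK that by (simp add: in_K_iff power2_eq_square)
    show ?thesis
    proof (cases "p2 = 0")
      case True
      have z: "z \<noteq> 0"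
        using pK(4) p0 True by auto
      define w where "w = y / z"
      have w: "w * cj w = 1"
        using norm_p[OF z] by (simp add: w_def)
      have P: "(0, 0, w, 1) \<in> W"
        using scale[OF pW, of "1 / z"] pK z True by (simp add: w_def)
      define c where "c = r2 / r1"
      define y' where "y' = ry / r1 - rz / r1 * w"
      have R: "(1, c, y', 0) \<in> W"
        using singular_plane_comb[OF W r(1) P, of "1 / r1" "- (rz / r1)"] r(2) rK
        by (simp add: c_def y'_def)
      note RK = singular_plane_mem[OF W R]
      \<comment> \<open>Otherwise \<open>(1, 0, 0, 0)\<close> would lie in \<open>W\<close> and be
        orthogonal to \<open>s\<close>, forcing \<open>s2 = 0\<close>.\<close>
      have c0: "c \<noteq> 0"
      proof
        assume "c = 0"
        then have "(1, 0, 0, 0) \<in> W"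
          using R RK(4) by simp
        from singular_plane_mem(4)[OF W singular_plane_comb[OF W s(1) this, of 1 1]]
        have "s1 * s2 + s2 + sy * cj sy = sz\<^sup>2"
          by (simp add: algebra_simps)
        then show False
          using sK(4) s(2) by (simp add: algebra_simps)
      qed
      have "(1, c, y' + w, 1) \<in> W"
        using singular_plane_comb[OF W R P, of 1 1] by simp
      from singular_plane_mem(4)[OF W this]
      have "c + y' * cj y' + (y' * cj w + w * cj y') + w * cj w = 1"
        by (simp add: algebra_simps)
      then have "y' * cj w + w * cj y' = 0"
        using RK(4) w by simp
      moreover have "c + y' * cj y' = 0"
        using RK(4) by simp
      ultimately have "card {x\<in>K. in_M (1, c, y' + x * w, x)} = (q - 1) div 2"
        using count_on_line_through_conic[OF w RK(2) c0] by simp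
      moreover have "\<not> in_M (0, 0, w, 1)"
        using eps_cases[OF w] by auto
      moreover have "lin_indep2 K (0, 0, w, 1) (1, c, y', 0)"
        by (simp add: lin_indep2_def zero_prod_def)
      ultimately show ?thesis
        using card_M_pts_line[OF W P R] by (simp del: in_M.simps)
    next
      case False
      \<comment> \<open>Subtracting a multiple of the vector with \<open>x1 = 0\<close> yields one
        with \<open>x2 = 0\<close>.\<close>
      define t1 ty tz where "t1 = r1" and "ty = ry - r2 / p2 * y" and "tz = rz - r2 / p2 * z"
      have T: "(t1, 0, ty, tz) \<in> W"
        using singular_plane_comb[OF W r(1) pW, of 1 "- (r2 / p2)"] False rK pK
        by (simp add: t1_def ty_def tz_def)
      note TK = singular_plane_mem[OF W T]
      have sum: "t1 * p2 + (y + ty) * cj (y + ty) = (z + tz)\<^sup>2"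
        using singular_plane_mem(4)[OF W singular_plane_comb[OF W pW T, of 1 1]] by simp
      \<comment> \<open>If \<open>z\<close> or \<open>tz\<close> vanished, so would \<open>y\<close>
        or \<open>ty\<close> respectively, and the polar form of the two vectors would equal
        \<open>t1 * p2\<close>, which is nonzero.\<close>
      have z: "z \<noteq> 0"
      proof
        assume "z = 0"
        then show False
          using sum pK(4) TK(4) False r(2) by (simp add: t1_def)
      qed
      have tz: "tz \<noteq> 0"
      proof
        assume "tz = 0"
        then show False
          using sum pK(4) TK(4) False r(2) by (simp add: t1_def)
      qed
      define w1 w2 b c where "w1 = y / z" and "w2 = ty / tz" and "b = p2 / z" and "c = t1 / tz"
      have w: "w1 * cj w1 = 1" "w2 * cj w2 = 1"
        using norm_p[OF z] TK tz by (simp_all add: w1_def w2_def in_K_iff power2_eq_square)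
      have bc: "b \<in> K" "b \<noteq> 0" "c \<in> K" "c \<noteq> 0"
        using pK TK False r(2) z tz by (simp_all add: b_def c_def t1_def)
      have P: "(0, b, w1, 1) \<in> W"
        using scale[OF pW, of "1 / z"] z pK by (simp add: b_def w1_def)
      have R: "(c, 0, w2, 1) \<in> W"
        using scale[OF T, of "1 / tz"] tz TK by (simp add: c_def w2_def)
      have "c * b + (w2 + w1) * cj (w2 + w1) = 4"
        using singular_plane_mem(4)[OF W singular_plane_comb[OF W R P, of 1 1]] by simp
      note count = count_on_general_line[OF w bc this]
      have "lin_indep2 K (0, b, w1, 1) (c, 0, w2, 1)"
        using bc by (simp add: lin_indep2_def zero_prod_def)
      then show ?thesis
        using card_M_pts_line[OF W P R] count by (simp del: in_M.simps)
    qed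
  qed
qed

end

theorem theorem3:
  fixes q :: nat
    and K :: "'a::{field, finite} set"
    and a d \<mu> :: 'a
  assumes "primepow q"
    and "[q = 3] (mod 4)"
    and "CARD('a) = q\<^sup>2"
    and "is_subfield K"
    and "card K = q"
    and "a \<in> K" and "a \<noteq> 0"
    and "nonzero_square K (1 + a\<^sup>2)"
    and "d \<in> K" and "d \<noteq> 0"
    and "d\<^sup>2 = a powi (- 2) + 1"
    and "\<mu> ^ (q + 1) = - 1"
  shows "m_ovoid q K ((q - 1) div 2) (M_set q K a d \<mu>)"
proof -
  interpret quadratic_extension q K
    using assms(1-5) by unfold_locales
  interpret ovoid_data q K a d \<mu>
  proof
    show "a\<^sup>2 * d\<^sup>2 = 1 + a\<^sup>2"
      using assms(7,11) by (simp add: power_int_minus field_simps)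
    show "\<mu> * cj \<mu> = - 1"
      using assms(12) by (simp add: cj_def)
  qed (use assms in auto)
  show ?thesis
    unfolding m_ovoid_def M_set_eq_M_pts
  proof (intro conjI ballI)
    show "(q - 1) div 2 > 0"
      using q_ge_3 by simp
    show "M_pts \<subseteq> Q_points q K"
      by (auto simp: M_pts_def singular_vecs_def pt_in_Q_points_iff)
    fix L assume "L \<in> Q_lines q K"
    then obtain W where "singular_plane W" "L = {P \<in> PG_points K. P \<subseteq> W}"
      by (rule Q_line_singular_plane)
    then show "card (M_pts \<inter> L) = (q - 1) div 2"
      using card_M_pts_singular_plane by simp
  qed
qed

end
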